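(* Let $\kappa,\tau\in\mathbb{R}$ with $\tau\neq0$ and $\kappa-4\tau^2\ne0$. Then the manifold $\mathbb{E}^*(\kappa,\tau)$ is isometrically immersed into $\mathbb{M}^4(c)$ for some $c\in\mathbb{R}\setminus\{0\}$. Moreover, $\mathbb{E}^*(\kappa,\tau)$ is (as such an immersed hypersurface) of constant mean curvature and $\eta$-umbilic.
   Context: $\mathbb{E}^*(\kappa,\tau)$ ($\tau\neq0$, $\kappa-4\tau^2\ne0$) denotes the simply connected 3-dimensional homogeneous Riemannian manifold with 4-dimensional isometry group which is a Riemannian fibration, with geodesic fibers and bundle curvature $\tau$, over the simply connected surface $\mathbb{M}^2(\kappa)$ of constant curvature $\kappa$. The unit vertical field $\xi$ is a Killing field with $\nabla_X\xi=\tau\,X\wedge\xi$ (cross product). There is a local direct orthonormal frame $\{e_1,e_2,e_3=\xi\}$ whose Christoffel symbols $\Gamma_{ij}^k=\langle\nabla_{e_i}e_j,e_k\rangle$ are $$\Gamma_{12}^3=\Gamma_{23}^1=-\Gamma_{21}^3=-\Gamma_{13}^2=\tau,\qquad \Gamma_{32}^1=-\Gamma_{31}^2=\tau-\frac{\kappa}{2\tau},$$ and $\Gamma_{ii}^i=\Gamma_{ij}^i=\Gamma_{ji}^i=\Gamma_{ii}^j=0$ for all $i,j\in\{1,2,3\}$. $\mathbb{M}^4(c)$ denotes the complex space form of real dimension 4 (complex dimension 2) and constant holomorphic sectional curvature $4c$. Let $\eta=\langle\xi,\cdot\rangle$. An immersed hypersurface with Weingarten map $II$ is called $\eta$-umbilic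 if $II=a\,\mathrm{Id}+b\,\eta\otimes\xi$ for some real functions $a,b$ (that is, $II(X)=aX+b\,\eta(X)\xi$). The mean curvature is $\frac13\mathrm{tr}(II)$. *)

theory Defs
  imports "HOL-Analysis.Analysis"
begin

section \<open>Smooth maps between open subsets of Euclidean spaces\<close>

primrec C_k_on :: "nat \<Rightarrow> ('a::euclidean_space \<Rightarrow> 'b::euclidean_space) \<Rightarrow> 'a set \<Rightarrow> bool" where
  "C_k_on 0 f U \<longleftrightarrow> continuous_on U f"
| "C_k_on (Suc k) f U \<longleftrightarrow> (\<forall>x\<in>U. f differentiable (at x)) \<and>
     (\<forall>v. C_k_on k (\<lambda>x. frechet_derivative f (at x) v) U)"

definition C_infinity_on :: "('a::euclidean_space \<Rightarrow> 'b::euclidean_space) \<Rightarrow> 'a set \<Rightarrow> bool" where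
  "C_infinity_on f U \<longleftrightarrow> open U \<and> (\<forall>k. C_k_on k f U)"


section \<open>Riemannian manifolds given by an atlas\<close>

text \<open>
  A Riemannian manifold is presented, as in do Carmo's textbook, by a set of injective local
  parametrizations \<open>cpar :: 'e \<Rightarrow> 'p\<close>, defined on open subsets \<open>cdom\<close> of a Euclidean space, whose
  images cover the manifold; \<open>cmet x u v\<close> is the metric, evaluated at the point with coordinates
  \<open>x\<close> on the tangent vectors with coordinate expressions \<open>u\<close> and \<open>v\<close>. The manifolds
  to which this is applied are the ones constructed at the end of the theory, whose changes of
  charts are smooth isometries.
\<close>

record ('e, 'p) chart =
  cdom :: "'e set"
  cpar :: "'e \<Rightarrow> 'p"
  cmet :: "'e \<Rightarrow> 'e \<Rightarrow> 'e \<Rightarrow> real"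

definition cimage :: "('e, 'p) chart \<Rightarrow> 'p set" where
  "cimage P = cpar P ` cdom P"

definition coord :: "('e, 'p) chart \<Rightarrow> 'p \<Rightarrow> 'e" where
  "coord P = the_inv_into (cdom P) (cpar P)"

definition points :: "('e, 'p) chart set \<Rightarrow> 'p set" where
  "points M = (\<Union>P\<in>M. cimage P)"

definition rep_dom :: "('p \<Rightarrow> 'q) \<Rightarrow> ('d, 'p) chart \<Rightarrow> ('e, 'q) chart \<Rightarrow> 'd set" where
  "rep_dom f P Q = {x \<in> cdom P. f (cpar P x) \<in> cimage Q}"

definition rep :: "('p \<Rightarrow> 'q) \<Rightarrow> ('d, 'p) chart \<Rightarrow> ('e, 'q) chart \<Rightarrow> 'd \<Rightarrow> 'e" where
  "rep f P Q x = coord Q (f (cpar P x))"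

definition drep ::
  "('p \<Rightarrow> 'q) \<Rightarrow> ('d::euclidean_space, 'p) chart \<Rightarrow> ('e::euclidean_space, 'q) chart \<Rightarrow> 'd \<Rightarrow> 'd \<Rightarrow> 'e"
  where "drep f P Q x = frechet_derivative (rep f P Q) (at x)"

definition smooth_map ::
  "('d::euclidean_space, 'p) chart set \<Rightarrow> ('e::euclidean_space, 'q) chart set \<Rightarrow> ('p \<Rightarrow> 'q) \<Rightarrow> bool"
  where "smooth_map E M f \<longleftrightarrow> f ` points E \<subseteq> points M \<and>
    (\<forall>P\<in>E. \<forall>Q\<in>M. C_infinity_on (rep f P Q) (rep_dom f P Q))"

definition isometric_immersion ::
  "('d::euclidean_space, 'p) chart set \<Rightarrow> ('e::euclidean_space, 'q) chart set \<Rightarrow> ('p \<Rightarrow> 'q) \<Rightarrow> bool"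
  where "isometric_immersion E M f \<longleftrightarrow> smooth_map E M f \<and>
    (\<forall>P\<in>E. \<forall>Q\<in>M. \<forall>x\<in>rep_dom f P Q.
       inj (drep f P Q x) \<and>
       (\<forall>u v. cmet Q (rep f P Q x) (drep f P Q x u) (drep f P Q x v) = cmet P x u v))"

text \<open>
  The Levi-Civita connection in a chart: \<open>christoffel Q y u v\<close> is \<open>\<nabla>\<^sub>u v\<close> at \<open>y\<close>, for \<open>u\<close> and \<open>v\<close>
  regarded as constant coordinate vector fields (whose brackets vanish), as determined by the
  Koszul formula.
\<close>

definition christoffel :: "('e::euclidean_space, 'q) chart \<Rightarrow> 'e \<Rightarrow> 'e \<Rightarrow> 'e \<Rightarrow> 'e" where
  "christoffel Q y u v = (THE z. \<forall>w. 2 * cmet Q y z w =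
       frechet_derivative (\<lambda>y. cmet Q y v w) (at y) u
     + frechet_derivative (\<lambda>y. cmet Q y u w) (at y) v
     - frechet_derivative (\<lambda>y. cmet Q y u v) (at y) w)"


section \<open>Hypersurfaces\<close>

text \<open>
  A vector field \<open>N\<close> along \<open>f\<close> assigns to \<open>p\<close> a tangent vector at \<open>f p\<close>; \<open>N Q p\<close> is its
  expression in the chart \<open>Q\<close>. The first condition is the transformation law under a change of
  charts.
\<close>

definition smooth_field_along ::
  "('d::euclidean_space, 'p) chart set \<Rightarrow> ('e::euclidean_space, 'q) chart set \<Rightarrow> ('p \<Rightarrow> 'q)
    \<Rightarrow> (('e, 'q) chart \<Rightarrow> 'p \<Rightarrow> 'e) \<Rightarrow> bool"
  where "smooth_field_along E M f N \<longleftrightarrow>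
    (\<forall>p\<in>points E. \<forall>Q\<in>M. \<forall>Q'\<in>M. f p \<in> cimage Q \<inter> cimage Q' \<longrightarrow>
       N Q' p = drep id Q Q' (coord Q (f p)) (N Q p)) \<and>
    (\<forall>P\<in>E. \<forall>Q\<in>M. C_infinity_on (\<lambda>x. N Q (cpar P x)) (rep_dom f P Q))"

definition unit_normal_field ::
  "('d::euclidean_space, 'p) chart set \<Rightarrow> ('e::euclidean_space, 'q) chart set \<Rightarrow> ('p \<Rightarrow> 'q)
    \<Rightarrow> (('e, 'q) chart \<Rightarrow> 'p \<Rightarrow> 'e) \<Rightarrow> bool"
  where "unit_normal_field E M f N \<longleftrightarrow> smooth_field_along E M f N \<and>
    (\<forall>P\<in>E. \<forall>Q\<in>M. \<forall>x\<in>rep_dom f P Q.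
       cmet Q (rep f P Q x) (N Q (cpar P x)) (N Q (cpar P x)) = 1 \<and>
       (\<forall>u. cmet Q (rep f P Q x) (drep f P Q x u) (N Q (cpar P x)) = 0))"

definition covariant_derivative ::
  "('p \<Rightarrow> 'q) \<Rightarrow> (('e, 'q) chart \<Rightarrow> 'p \<Rightarrow> 'e)
    \<Rightarrow> ('d::euclidean_space, 'p) chart \<Rightarrow> ('e::euclidean_space, 'q) chart \<Rightarrow> 'd \<Rightarrow> 'd \<Rightarrow> 'e"
  where "covariant_derivative f N P Q x u =
    frechet_derivative (\<lambda>x. N Q (cpar P x)) (at x) u
    + christoffel Q (rep f P Q x) (drep f P Q x u) (N Q (cpar P x))"

text \<open>The Weingarten map, characterized by \<open>df (II u) = - \<nabla>\<^sub>u N\<close>.\<close>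

definition weingarten ::
  "('p \<Rightarrow> 'q) \<Rightarrow> (('e, 'q) chart \<Rightarrow> 'p \<Rightarrow> 'e)
    \<Rightarrow> ('d::euclidean_space, 'p) chart \<Rightarrow> ('e::euclidean_space, 'q) chart \<Rightarrow> 'd \<Rightarrow> 'd \<Rightarrow> 'd"
  where "weingarten f N P Q x u =
    (THE v. drep f P Q x v = - covariant_derivative f N P Q x u)"

definition mean_curvature ::
  "('p \<Rightarrow> 'q) \<Rightarrow> (('e, 'q) chart \<Rightarrow> 'p \<Rightarrow> 'e)
    \<Rightarrow> ('d::euclidean_space, 'p) chart \<Rightarrow> ('e::euclidean_space, 'q) chart \<Rightarrow> 'd \<Rightarrow> real"
  where "mean_curvature f N P Q x =
    (\<Sum>b\<in>Basis. weingarten f N P Q x b \<bullet> b) / real DIM('d)"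

definition constant_mean_curvature ::
  "('d::euclidean_space, 'p) chart set \<Rightarrow> ('e::euclidean_space, 'q) chart set \<Rightarrow> ('p \<Rightarrow> 'q)
    \<Rightarrow> (('e, 'q) chart \<Rightarrow> 'p \<Rightarrow> 'e) \<Rightarrow> bool"
  where "constant_mean_curvature E M f N \<longleftrightarrow>
    (\<exists>H. \<forall>P\<in>E. \<forall>Q\<in>M. \<forall>x\<in>rep_dom f P Q. mean_curvature f N P Q x = H)"

text \<open>
  \<open>\<eta>\<close>-umbilicity with respect to a vector field \<open>\<xi>\<close> on \<open>E\<close>, given by its coordinate expressions
  \<open>\<xi> P x\<close>; here \<open>\<eta> = \<langle>\<xi>, \<cdot>\<rangle>\<close>.
\<close>

definition eta_umbilic ::
  "(('d, 'p) chart \<Rightarrow> 'd \<Rightarrow> 'd)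
    \<Rightarrow> ('d::euclidean_space, 'p) chart set \<Rightarrow> ('e::euclidean_space, 'q) chart set \<Rightarrow> ('p \<Rightarrow> 'q)
    \<Rightarrow> (('e, 'q) chart \<Rightarrow> 'p \<Rightarrow> 'e) \<Rightarrow> bool"
  where "eta_umbilic \<xi> E M f N \<longleftrightarrow>
    (\<exists>a b :: 'p \<Rightarrow> real. \<forall>P\<in>E. \<forall>Q\<in>M. \<forall>x\<in>rep_dom f P Q. \<forall>u.
       weingarten f N P Q x u =
         a (cpar P x) *\<^sub>R u + (b (cpar P x) * cmet P x (\<xi> P x) u) *\<^sub>R \<xi> P x)"


section \<open>The homogeneous spaces \<open>\<bbbE>(\<kappa>, \<tau>)\<close>\<close>

text \<open>
  For \<open>\<kappa> \<le> 0\<close>: the global model \<open>{(x, y, z). 1 + \<kappa>/4 (x\<^sup>2 + y\<^sup>2) > 0}\<close> with metric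
  \<open>\<lambda>\<^sup>2 (dx\<^sup>2 + dy\<^sup>2) + (dz + \<tau> \<lambda> (y dx - x dy))\<^sup>2\<close>, where \<open>\<lambda> = 1 / (1 + \<kappa>/4 (x\<^sup>2 + y\<^sup>2))\<close>. It fibers
  over the disc or plane of curvature \<open>\<kappa>\<close> by \<open>(x, y, z) \<mapsto> (x, y)\<close>, and \<open>\<xi> = \<partial>\<^sub>z\<close>. Its points are
  stored in \<open>\<complex>\<^sup>2\<close> as \<open>(x + \<i> y, z)\<close>, only to share a type with the next case.
\<close>

definition E_chart_nonpos :: "real \<Rightarrow> real \<Rightarrow> (real^3, complex^2) chart" where
  "E_chart_nonpos \<kappa> \<tau> = \<lparr>
     cdom = {x. 1 + \<kappa> / 4 * ((x$1)\<^sup>2 + (x$2)\<^sup>2) > 0},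
     cpar = (\<lambda>x. vector [Complex (x$1) (x$2), complex_of_real (x$3)]),
     cmet = (\<lambda>x u v.
       let l = 1 / (1 + \<kappa> / 4 * ((x$1)\<^sup>2 + (x$2)\<^sup>2));
           \<theta> = (\<lambda>w. w$3 + \<tau> * l * (x$2 * w$1 - x$1 * w$2))
       in l\<^sup>2 * (u$1 * v$1 + u$2 * v$2) + \<theta> u * \<theta> v) \<rparr>"

text \<open>
  For \<open>\<kappa> > 0\<close>: the Berger sphere, i.e. the unit sphere of \<open>\<complex>\<^sup>2\<close> with the metric
  \<open>4/\<kappa> (\<langle>X, Y\<rangle> + (4\<tau>\<^sup>2/\<kappa> - 1) \<langle>X, V\<rangle> \<langle>Y, V\<rangle>)\<close>, where \<open>V\<^sub>p = \<i> p\<close> spans the fibers of the Hopf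
  fibration, and \<open>\<xi> = \<kappa>/(4\<tau>) V\<close>. The charts are the inverses of the stereographic projections
  (\<open>s = 1\<close> and \<open>s = -1\<close>), the metric being pulled back by them.
\<close>

definition berger_metric :: "real \<Rightarrow> real \<Rightarrow> complex^2 \<Rightarrow> complex^2 \<Rightarrow> complex^2 \<Rightarrow> real" where
  "berger_metric \<kappa> \<tau> p X Y =
     4 / \<kappa> * (X \<bullet> Y + (4 * \<tau>\<^sup>2 / \<kappa> - 1) * (X \<bullet> (\<i> *s p)) * (Y \<bullet> (\<i> *s p)))"

definition stereographic :: "real \<Rightarrow> real^3 \<Rightarrow> complex^2" where
  "stereographic s x = (1 / (1 + (norm x)\<^sup>2)) *\<^sub>R
     vector [Complex (2 * x$1) (2 * x$2), Complex (2 * x$3) (s * ((norm x)\<^sup>2 - 1))]"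

definition E_chart_pos :: "real \<Rightarrow> real \<Rightarrow> real \<Rightarrow> (real^3, complex^2) chart" where
  "E_chart_pos \<kappa> \<tau> s = \<lparr>
     cdom = UNIV,
     cpar = stereographic s,
     cmet = (\<lambda>x u v. berger_metric \<kappa> \<tau> (stereographic s x)
       (frechet_derivative (stereographic s) (at x) u)
       (frechet_derivative (stereographic s) (at x) v)) \<rparr>"

definition E_space :: "real \<Rightarrow> real \<Rightarrow> (real^3, complex^2) chart set" where
  "E_space \<kappa> \<tau> =
     (if \<kappa> \<le> 0 then {E_chart_nonpos \<kappa> \<tau>} else {E_chart_pos \<kappa> \<tau> 1, E_chart_pos \<kappa> \<tau> (-1)})"

definition E_vertical :: "real \<Rightarrow> real \<Rightarrow> (real^3, complex^2) chart \<Rightarrow> real^3 \<Rightarrow> real^3" where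
  "E_vertical \<kappa> \<tau> P x =
     (if \<kappa> \<le> 0 then axis 3 1
      else (THE u. frechet_derivative (cpar P) (at x) u = (\<kappa> / (4 * \<tau>)) *\<^sub>R (\<i> *s cpar P x)))"


section \<open>The complex space forms of complex dimension two\<close>

text \<open>
  Points are complex lines in \<open>\<complex>\<^sup>3\<close>: all of them for \<open>c > 0\<close> (complex projective plane), the ones
  spanned by \<open>(1, z)\<close> with \<open>|z| < 1\<close> for \<open>c < 0\<close> (complex hyperbolic plane). The metric (Fubini-Study,
  respectively Bergman) in the affine charts, rescaled by \<open>z = sqrt \<bar>c\<bar> w\<close>, is
  \<open>((1 + c |w|\<^sup>2) |dw|\<^sup>2 - c |\<langle>dw, w\<rangle>|\<^sup>2) / (1 + c |w|\<^sup>2)\<^sup>2\<close>; its holomorphic sectional curvature is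
  \<open>4c\<close> (on the complex line \<open>w$2 = 0\<close> it is \<open>|dw|\<^sup>2 / (1 + c |w|\<^sup>2)\<^sup>2\<close>). For \<open>c < 0\<close> the first
  affine chart is global. The value at \<open>c = 0\<close> plays no role.
\<close>

definition hermitian :: "complex^2 \<Rightarrow> complex^2 \<Rightarrow> complex" where
  "hermitian u v = (\<Sum>i\<in>UNIV. u$i * cnj (v$i))"

definition complex_line :: "complex^3 \<Rightarrow> (complex^3) set" where
  "complex_line v = range (\<lambda>a. a *s v)"

definition affine_embedding :: "3 \<Rightarrow> complex^2 \<Rightarrow> complex^3" where
  "affine_embedding i z =
     (if i = 1 then vector [1, z$1, z$2]
      else if i = 2 then vector [z$1, 1, z$2]
      else vector [z$1, z$2, 1])"

definition M4_chart :: "real \<Rightarrow> 3 \<Rightarrow> (complex^2, (complex^3) set) chart" where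
  "M4_chart c i = \<lparr>
     cdom = {w. 1 + c * (norm w)\<^sup>2 > 0},
     cpar = (\<lambda>w. complex_line (affine_embedding i (sqrt \<bar>c\<bar> *\<^sub>R w))),
     cmet = (\<lambda>w u v.
       Re (complex_of_real (1 + c * (norm w)\<^sup>2) * hermitian u v
           - complex_of_real c * hermitian u w * hermitian w v)
       / (1 + c * (norm w)\<^sup>2)\<^sup>2) \<rparr>"

definition M4_space :: "real \<Rightarrow> (complex^2, (complex^3) set) chart set" where
  "M4_space c = (if c < 0 then {M4_chart c 1} else range (M4_chart c))"

end

theory Submission
  imports Defs
begin

text \<open>
  Put \<open>c = \<kappa>/4 - \<tau>\<^sup>2\<close>. The points of \<open>M\<^sup>4(c)\<close> are the complex lines in \<open>\<complex>\<^sup>3\<close> on which the form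
  \<open>\<langle>Z, Y\<rangle> = Z\<^sub>1 cnj Y\<^sub>1 + sgn c (Z\<^sub>2 cnj Y\<^sub>2 + Z\<^sub>3 cnj Y\<^sub>3)\<close> is positive. Fix a vector \<open>pole\<close>. The level sets
  of \<open>|\<langle>pole, Z\<rangle>|\<^sup>2 / \<langle>Z, Z\<rangle>\<close> are geodesic spheres if the pole is positive, horospheres if it is null,
  and tubes around the complex geodesic orthogonal to the pole if it is negative. At suitable
  distances these are the images of \<open>\<bbbE>(\<kappa>, \<tau>)\<close> for \<open>\<kappa> > 0\<close>, \<open>\<kappa> = 0\<close> and \<open>\<kappa> < 0\<close> respectively.

  One computation covers the three cases. In each of them \<open>\<bbbE>(\<kappa>, \<tau>)\<close> lifts to a map \<open>F\<close> into \<open>\<complex>\<^sup>3\<close>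
  for which \<open>\<langle>F, F\<rangle> = k\<close> and \<open>\<langle>pole, F\<rangle> = m\<close> are constant, and the unit normal is the image in the
  complex space form of a constant multiple \<open>\<nu> pole\<close> of the pole. Since this vector is constant, its
  covariant derivative comes only from the connection of the complex space form, which in
  homogeneous coordinates gives
    \<open>- \<nabla>\<^sub>u N = (\<langle>dF u, F\<rangle> / k) \<nu> pole + (\<langle>\<nu> pole, F\<rangle> / k) dF u\<close>  modulo \<open>F\<close>.
  The second term is the multiple \<open>\<nu> m / k\<close> of \<open>dF u\<close>. In the first one, \<open>\<langle>dF u, F\<rangle>\<close> is \<open>\<i> \<rho> \<eta>(u)\<close> for a
  constant \<open>\<rho>\<close>, and \<open>\<i> pole\<close> is a constant multiple of \<open>dF \<xi>\<close> modulo \<open>F\<close>. So the Weingarten map is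
  \<open>a Id + b \<eta> \<otimes> \<xi>\<close> with constants \<open>a\<close> and \<open>b\<close>, which yields both \<open>\<eta>\<close>-umbilicity and constant mean
  curvature.

  The connection is \<open>christoffel_M4_chart\<close>, and \<open>christoffel_affine_push\<close> in homogeneous coordinates;
  the computation above is carried out in the locale \<open>pole_lift\<close>; the three lifts are provided by
  \<open>pole_lift_sphere\<close>, \<open>pole_lift_horosphere\<close> and \<open>pole_lift_tube\<close>. All conditions on \<open>F\<close> are stated
  in \<open>\<complex>\<^sup>3\<close>, so that the three affine charts of the projective plane need no separate treatment.
\<close>


section \<open>Functions of class \<open>C\<^sup>k\<close>\<close>

lemma C_k_on_cong:
  assumes "open U" and "\<And>x. x \<in> U \<Longrightarrow> f x = g x"
  shows "C_k_on k f U \<longleftrightarrow> C_k_on k g U"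
  using assms(2)
proof (induction k arbitrary: f g)
  case 0
  then show ?case by (simp cong: continuous_on_cong)
next
  case (Suc k)
  have *: "(f has_derivative D) (at x) \<longleftrightarrow> (g has_derivative D) (at x)" if "x \<in> U" for x D
    using has_derivative_transform_within_open[OF _ \<open>open U\<close> that] Suc.prems by (metis (full_types))
  have "f differentiable (at x) \<longleftrightarrow> g differentiable (at x)" if "x \<in> U" for x
    using * that by (simp add: differentiable_def)
  moreover have "frechet_derivative f (at x) = frechet_derivative g (at x)" if "x \<in> U" for x
    using * that by (simp add: frechet_derivative_def)
  then have "C_k_on k (\<lambda>x. frechet_derivative f (at x) v) U
      \<longleftrightarrow> C_k_on k (\<lambda>x. frechet_derivative g (at x) v) U" for v
    by (intro Suc.IH) simp
  ultimately show ?case by simp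
qed

text \<open>Derivatives on an open set are unique, so an explicitly computed derivative can replace the
  \<open>frechet_derivative\<close> that the definition of \<open>C_k_on\<close> speaks of.\<close>

lemma C_k_on_SucI:
  assumes "open U" and "\<And>x. x \<in> U \<Longrightarrow> (f has_derivative D x) (at x)"
    and "\<And>v. C_k_on k (\<lambda>x. D x v) U"
  shows "C_k_on (Suc k) f U"
proof -
  have "C_k_on k (\<lambda>x. frechet_derivative f (at x) v) U" for v
    using C_k_on_cong[OF \<open>open U\<close>, of "\<lambda>x. frechet_derivative f (at x) v" "\<lambda>x. D x v"]
      assms(2,3) frechet_derivative_at by metis
  then show ?thesis using assms(2) by (auto simp: differentiable_def)
qed

lemma C_k_on_SucD: "C_k_on (Suc k) f U \<Longrightarrow> C_k_on k f U"
proof (induction k arbitrary: f)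
  case 0
  then show ?case
    by (simp add: continuous_at_imp_continuous_on differentiable_imp_continuous_within)
next
  case (Suc k)
  then show ?case by (metis C_k_on.simps(2))
qed

lemma C_k_on_Suc_derivative:
  assumes "C_k_on (Suc k) f U"
  shows "x \<in> U \<Longrightarrow> (f has_derivative frechet_derivative f (at x)) (at x)"
    and "C_k_on k (\<lambda>x. frechet_derivative f (at x) v) U"
  using assms by (simp_all add: frechet_derivative_works)

lemma C_k_on_const: "open U \<Longrightarrow> C_k_on k (\<lambda>x. c) U"
  by (induction k arbitrary: c) auto

lemma C_k_on_bounded_linear:
  assumes "open U" and "bounded_linear L"
  shows "C_k_on k f U \<Longrightarrow> C_k_on k (\<lambda>x. L (f x)) U"
proof (induction k arbitrary: f)
  case 0
  then show ?case by (simp add: bounded_linear.continuous_on[OF assms(2)])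
next
  case (Suc k)
  show ?case
    by (rule C_k_on_SucI[OF assms(1), where D="\<lambda>x v. L (frechet_derivative f (at x) v)"])
      (use C_k_on_Suc_derivative[OF Suc.prems] Suc.IH in
        \<open>auto intro: bounded_linear.has_derivative[OF assms(2)]\<close>)
qed

lemma C_k_on_ident: "open U \<Longrightarrow> C_k_on k (\<lambda>x. x) U"
  by (cases k) (auto intro!: C_k_on_SucI[where D="\<lambda>x v. v"] C_k_on_const derivative_eq_intros)

lemma C_k_on_linear: "open U \<Longrightarrow> bounded_linear L \<Longrightarrow> C_k_on k L U"
  using C_k_on_bounded_linear C_k_on_ident by blast

lemma C_k_on_add:
  assumes "open U"
  shows "C_k_on k f U \<Longrightarrow> C_k_on k g U \<Longrightarrow> C_k_on k (\<lambda>x. f x + g x) U"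
proof (induction k arbitrary: f g)
  case 0
  then show ?case by (simp add: continuous_on_add)
next
  case (Suc k)
  show ?case
    by (rule C_k_on_SucI[OF assms, where
          D="\<lambda>x v. frechet_derivative f (at x) v + frechet_derivative g (at x) v"])
      (use C_k_on_Suc_derivative[OF Suc.prems(1)] C_k_on_Suc_derivative[OF Suc.prems(2)] Suc.IH in
        \<open>auto intro: has_derivative_add\<close>)
qed

lemma C_k_on_bilinear:
  assumes "open U" and "bounded_bilinear B"
  shows "C_k_on k f U \<Longrightarrow> C_k_on k g U \<Longrightarrow> C_k_on k (\<lambda>x. B (f x) (g x)) U"
proof (induction k arbitrary: f g)
  case 0
  then show ?case by (simp add: bounded_bilinear.continuous_on[OF assms(2)])
next
  case (Suc k)
  show ?case
  proof (rule C_k_on_SucI[OF assms(1)])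
    show "((\<lambda>x. B (f x) (g x)) has_derivative
        (\<lambda>v. B (f x) (frechet_derivative g (at x) v) + B (frechet_derivative f (at x) v) (g x)))
        (at x)" if "x \<in> U" for x
      using that C_k_on_Suc_derivative(1)[OF Suc.prems(1)] C_k_on_Suc_derivative(1)[OF Suc.prems(2)]
      by (intro bounded_bilinear.FDERIV[OF assms(2)])
    show "C_k_on k (\<lambda>x. B (f x) (frechet_derivative g (at x) v)
        + B (frechet_derivative f (at x) v) (g x)) U" for v
      using C_k_on_Suc_derivative(2)[OF Suc.prems(1)] C_k_on_Suc_derivative(2)[OF Suc.prems(2)]
        C_k_on_SucD[OF Suc.prems(1)] C_k_on_SucD[OF Suc.prems(2)]
      by (intro C_k_on_add Suc.IH assms)
  qed
qed

lemmas C_k_on_mult = C_k_on_bilinear[OF _ bounded_bilinear_mult]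

lemma C_k_on_power:
  fixes f :: "_ \<Rightarrow> 'a::{euclidean_space, real_normed_algebra_1}"
  shows "open U \<Longrightarrow> C_k_on k f U \<Longrightarrow> C_k_on k (\<lambda>x. f x ^ n) U"
  by (induction n) (auto intro: C_k_on_const C_k_on_mult)

text \<open>For \<open>h\<close> one of \<open>t\<^sup>-\<^sup>1\<close>, \<open>exp t\<close> and \<open>t\<^sup>-\<^sup>1\<^sup>/\<^sup>2\<close>, the derivative of \<open>h \<circ> f\<close> is a polynomial in
  \<open>h \<circ> f\<close> itself and \<open>df\<close>. If \<open>f\<close> is of class \<open>C\<^sup>k\<^sup>+\<^sup>1\<close> and \<open>h \<circ> f\<close> is already known to be of
  class \<open>C\<^sup>k\<close>, then so is this derivative: the induction on \<open>k\<close> feeds on its own conclusion.\<close>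

lemma C_k_on_inverse:
  fixes f :: "_ \<Rightarrow> 'a::{euclidean_space, real_normed_div_algebra}"
  assumes "open U" and nz: "\<And>x. x \<in> U \<Longrightarrow> f x \<noteq> 0"
  shows "C_k_on k f U \<Longrightarrow> C_k_on k (\<lambda>x. inverse (f x)) U"
proof (induction k)
  case 0
  then show ?case using nz by (auto intro: continuous_on_inverse)
next
  case (Suc k)
  have inv: "C_k_on k (\<lambda>x. inverse (f x)) U"
    by (rule Suc.IH[OF C_k_on_SucD[OF Suc.prems]])
  show ?case
  proof (rule C_k_on_SucI[OF assms(1)])
    show "((\<lambda>x. inverse (f x)) has_derivative
        (\<lambda>v. (- inverse (f x)) * frechet_derivative f (at x) v * inverse (f x))) (at x)"
      if "x \<in> U" for x
      using Deriv.has_derivative_inverse[OF nz[OF that] C_k_on_Suc_derivative(1)[OF Suc.prems that]]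
      by simp
    show "C_k_on k (\<lambda>x. (- inverse (f x)) * frechet_derivative f (at x) v * inverse (f x)) U" for v
      using C_k_on_bounded_linear[OF assms(1) bounded_linear_minus[OF bounded_linear_ident] inv]
      by (intro C_k_on_mult assms inv C_k_on_Suc_derivative(2)[OF Suc.prems])
  qed
qed

lemma C_k_on_exp:
  fixes f :: "_ \<Rightarrow> 'a::{euclidean_space, real_normed_field, banach}"
  assumes "open U"
  shows "C_k_on k f U \<Longrightarrow> C_k_on k (\<lambda>x. exp (f x)) U"
proof (induction k)
  case 0
  then show ?case by (auto intro: continuous_on_exp)
next
  case (Suc k)
  have "((\<lambda>x. exp (f x)) has_derivative (\<lambda>v. exp (f x) * frechet_derivative f (at x) v)) (at x)"
    if "x \<in> U" for x
    using has_derivative_compose[OF C_k_on_Suc_derivative(1)[OF Suc.prems that]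
        DERIV_exp[unfolded has_field_derivative_def]]
    by simp
  then show ?case
    by (rule C_k_on_SucI[OF assms])
      (use C_k_on_Suc_derivative[OF Suc.prems] Suc.IH[OF C_k_on_SucD[OF Suc.prems]] in
        \<open>auto intro!: C_k_on_mult[OF assms]\<close>)
qed

lemma has_derivative_inverse_sqrt:
  fixes f :: "'a::real_normed_vector \<Rightarrow> real"
  assumes "(f has_derivative D) (at x)" and "f x > 0"
  shows "((\<lambda>x. inverse (sqrt (f x))) has_derivative
    (\<lambda>v. - (1/2) * (inverse (sqrt (f x)) ^ 3 * D v))) (at x)"
proof -
  have "((\<lambda>t. inverse (sqrt t)) has_real_derivative - (1/2) * inverse (sqrt (f x)) ^ 3) (at (f x))"
  proof -
    have "inverse (sqrt (f x)) * inverse (sqrt (f x)) = inverse (f x)"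
      using assms(2) by (simp flip: inverse_mult_distrib)
    then show ?thesis
      using assms(2) DERIV_inverse_fun[OF DERIV_real_sqrt[OF assms(2)]]
      by (simp add: power3_eq_cube power2_eq_square mult.assoc mult.commute[of "inverse (f x)"])
  qed
  from has_derivative_compose[OF assms(1) this[unfolded has_field_derivative_def]]
  show ?thesis by (simp add: mult.assoc)
qed

lemma C_k_on_inverse_sqrt:
  fixes f :: "_ \<Rightarrow> real"
  assumes "open U" and pos: "\<And>x. x \<in> U \<Longrightarrow> f x > 0"
  shows "C_k_on k f U \<Longrightarrow> C_k_on k (\<lambda>x. inverse (sqrt (f x))) U"
proof (induction k)
  case 0
  then show ?case using pos
    by (auto intro!: continuous_on_inverse continuous_on_real_sqrt simp: less_imp_neq[symmetric])
next
  case (Suc k)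
  show ?case
    by (rule C_k_on_SucI[OF assms(1) has_derivative_inverse_sqrt[OF
            C_k_on_Suc_derivative(1)[OF Suc.prems] pos]])
      (assumption | intro C_k_on_mult C_k_on_power C_k_on_const assms
        C_k_on_Suc_derivative(2)[OF Suc.prems] Suc.IH[OF C_k_on_SucD[OF Suc.prems]])+
qed

lemma C_infinity_onI: "open U \<Longrightarrow> (\<And>k. C_k_on k f U) \<Longrightarrow> C_infinity_on f U"
  by (simp add: C_infinity_on_def)

lemma C_infinity_on_cong:
  "C_infinity_on f U \<Longrightarrow> (\<And>x. x \<in> U \<Longrightarrow> g x = f x) \<Longrightarrow> C_infinity_on g U"
  unfolding C_infinity_on_def using C_k_on_cong by blast

lemma C_infinity_on_has_derivative:
  "C_infinity_on f U \<Longrightarrow> x \<in> U \<Longrightarrow> (f has_derivative frechet_derivative f (at x)) (at x)"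
  unfolding C_infinity_on_def using C_k_on_Suc_derivative(1) by blast

lemma C_k_on_mono_set: "V \<subseteq> U \<Longrightarrow> C_k_on k f U \<Longrightarrow> C_k_on k f V"
  by (induction k arbitrary: f) (auto intro: continuous_on_subset)

lemma bounded_bilinear_vector_scalar_mult:
  "bounded_bilinear ((*s) :: complex \<Rightarrow> complex^'n \<Rightarrow> complex^'n)"
proof -
  have "bilinear ((*s) :: complex \<Rightarrow> complex^'n \<Rightarrow> complex^'n)"
    by (auto simp: bilinear_def linear_iff vec_eq_iff algebra_simps)
  then show ?thesis by (simp add: bilinear_conv_bounded_bilinear)
qed

lemmas C_k_on_vector_scalar_mult = C_k_on_bilinear[OF _ bounded_bilinear_vector_scalar_mult]

lemma vector_3_decomp:
  "vector [a, b, c] = a *s axis 1 1 + b *s axis 2 1 + c *s (axis 3 1 :: complex^3)"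
  by (simp add: vec_eq_iff forall_3 axis_def)

lemma C_k_on_vector_3:
  assumes "open U" "C_k_on k f U" "C_k_on k g U" "C_k_on k h U"
  shows "C_k_on k (\<lambda>x. vector [f x, g x, h x] :: complex^3) U"
  unfolding vector_3_decomp
  by (intro C_k_on_add C_k_on_vector_scalar_mult C_k_on_const assms)

lemma has_derivative_vector_3:
  assumes "(f has_derivative f') F" "(g has_derivative g') F" "(h has_derivative h') F"
  shows "((\<lambda>x. vector [f x, g x, h x] :: complex^3) has_derivative
    (\<lambda>v. vector [f' v, g' v, h' v])) F"
  unfolding vector_3_decomp
  by (intro has_derivative_add bounded_linear.has_derivative[OF
        bounded_bilinear.bounded_linear_left[OF bounded_bilinear_vector_scalar_mult]] assms)

section \<open>The Levi-Civita connection of the complex space form\<close>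

lemma hermitian_simps [simp]:
  "hermitian (u + u') v = hermitian u v + hermitian u' v"
  "hermitian u (v + v') = hermitian u v + hermitian u v'"
  "hermitian (u - u') v = hermitian u v - hermitian u' v"
  "hermitian u (v - v') = hermitian u v - hermitian u v'"
  "hermitian (- u) v = - hermitian u v"
  "hermitian u (- v) = - hermitian u v"
  "hermitian (a *s u) v = a * hermitian u v"
  "hermitian u (a *s v) = cnj a * hermitian u v"
  "hermitian (r *\<^sub>R u) v = of_real r * hermitian u v"
  "hermitian u (r *\<^sub>R v) = of_real r * hermitian u v"
  "cnj (hermitian u v) = hermitian v u"
  by (simp_all add: hermitian_def sum_2 algebra_simps scaleR_conv_of_real[where 'a=complex])

lemma hermitian_self: "hermitian u u = complex_of_real ((norm u)\<^sup>2)"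
  by (simp add: hermitian_def sum_2 complex_norm_square[symmetric] norm_vec_def L2_set_def)

lemma norm_eq_hermitian: "(norm u)\<^sup>2 = Re (hermitian u u)"
  by (simp add: hermitian_self)

lemma Re_hermitian: "Re (hermitian u v) = u \<bullet> v"
  by (simp add: hermitian_def inner_vec_def inner_complex_def)

lemma bounded_bilinear_hermitian: "bounded_bilinear hermitian"
proof -
  have "bilinear hermitian"
    by (auto simp: bilinear_def linear_iff scaleR_conv_of_real[where 'a=complex])
  then show ?thesis by (simp add: bilinear_conv_bounded_bilinear)
qed

lemma cauchy_schwarz_hermitian: "(cmod (hermitian u v))\<^sup>2 \<le> (norm u)\<^sup>2 * (norm v)\<^sup>2"
proof (cases "v = 0")
  case False
  define a where "a = hermitian u v / hermitian v v"
  have nz: "hermitian v v \<noteq> 0" using False by (simp add: hermitian_self)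
  have "0 \<le> Re (hermitian (u - a *s v) (u - a *s v))"
    unfolding hermitian_self by simp
  also have "hermitian (u - a *s v) (u - a *s v)
      = hermitian u u - hermitian u v * hermitian v u / hermitian v v"
    using nz by (simp add: a_def field_simps)
  also have "hermitian u v * hermitian v u = of_real ((cmod (hermitian u v))\<^sup>2)"
    by (metis complex_norm_square hermitian_simps(11))
  finally show ?thesis
    using False by (simp add: hermitian_self field_simps flip: of_real_mult of_real_divide)
qed (simp add: hermitian_def)

lemma M4_chart_metric_diff_left:
  "cmet (M4_chart c i) w (u - u') v = cmet (M4_chart c i) w u v - cmet (M4_chart c i) w u' v"
  by (simp add: M4_chart_def algebra_simps add_divide_distrib diff_divide_distrib)

text \<open>For \<open>c \<ge> 0\<close> the negative term \<open>- c |\<langle>u, w\<rangle>|\<^sup>2\<close> is absorbed by \<open>c |w|\<^sup>2 |u|\<^sup>2\<close>, by Cauchy-Schwarz; for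
  \<open>c < 0\<close> it is nonnegative, and \<open>(1 + c |w|\<^sup>2) |u|\<^sup>2\<close> is positive on the domain of the chart.\<close>

lemma M4_chart_metric_definite:
  assumes "1 + c * (norm w)\<^sup>2 > 0" and "cmet (M4_chart c i) w u u = 0"
  shows "u = 0"
proof -
  define H where "H = hermitian u w"
  have "hermitian w u = cnj H" by (simp add: H_def)
  then have eq: "(1 + c * (norm w)\<^sup>2) * (norm u)\<^sup>2 - c * (cmod (hermitian u w))\<^sup>2 = 0"
    using assms
    by (simp add: M4_chart_def hermitian_self cmod_power2 H_def[symmetric])
      (simp add: power2_eq_square algebra_simps)
  show ?thesis
  proof (cases "c \<ge> 0")
    case True
    then have "c * (cmod (hermitian u w))\<^sup>2 \<le> c * ((norm u)\<^sup>2 * (norm w)\<^sup>2)"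
      by (intro mult_left_mono cauchy_schwarz_hermitian)
    then have "(norm u)\<^sup>2 \<le> 0" using eq
      unfolding distrib_right mult_1 mult.assoc mult.commute[of "(norm w)\<^sup>2"] by linarith
    then show ?thesis by simp
  next
    case False
    then have "c * (cmod (hermitian u w))\<^sup>2 \<le> 0"
      by (simp add: mult_nonpos_nonneg)
    then have "(1 + c * (norm w)\<^sup>2) * (norm u)\<^sup>2 \<le> 0" using eq by simp
    then show ?thesis using assms(1) by (simp add: mult_le_0_iff not_le)
  qed
qed

lemma M4_chart_metric_has_derivative:
  fixes c :: real and y v z :: "complex^2"
  defines "m \<equiv> 1 + c * (norm y)\<^sup>2"
  assumes "m > 0"
  shows "((\<lambda>y. cmet (M4_chart c i) y v z) has_derivative (\<lambda>u.
    (m * Re (2 * c * Re (hermitian u y) * hermitian v z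
         - c * (hermitian v u * hermitian y z + hermitian v y * hermitian u z))
     - 4 * c * Re (hermitian u y) * Re (m * hermitian v z - c * hermitian v y * hermitian y z)) / m^3))
    (at y)"
proof -
  note h = bounded_bilinear.FDERIV[OF bounded_bilinear_hermitian has_derivative_const has_derivative_ident]
    bounded_bilinear.FDERIV[OF bounded_bilinear_hermitian has_derivative_ident has_derivative_const]
    bounded_bilinear.FDERIV[OF bounded_bilinear_hermitian has_derivative_ident has_derivative_ident]
  define \<mu> where "\<mu> = (\<lambda>y :: complex^2. 1 + c * (norm y)\<^sup>2 :: real)"
  define n where "n = (\<lambda>y :: complex^2. Re (of_real (\<mu> y) * hermitian v z - of_real c * (hermitian v y * hermitian y z)))"
  have \<mu>': "(\<mu> has_derivative (\<lambda>u. 2 * c * Re (hermitian u y))) (at y)"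
  proof -
    have "(\<mu> has_derivative (\<lambda>u. c * Re (hermitian y u + hermitian u y))) (at y)"
      unfolding \<mu>_def norm_eq_hermitian
      by (rule derivative_eq_intros h refl | simp)+
    moreover have "Re (hermitian y u) = Re (hermitian u y)" for u
      by (simp add: Re_hermitian inner_commute)
    ultimately show ?thesis by (simp add: algebra_simps)
  qed
  have n': "(n has_derivative (\<lambda>u. Re (of_real (2 * c * Re (hermitian u y)) * hermitian v z
      - of_real c * (hermitian v u * hermitian y z + hermitian v y * hermitian u z)))) (at y)"
    unfolding n_def
    by (rule derivative_eq_intros h \<mu>' refl
        | simp add: hermitian_def fun_eq_iff algebra_simps)+
  have "\<mu> y > 0" using assms by (simp add: \<mu>_def)
  have nz: "(\<mu> y)\<^sup>2 \<noteq> 0" using \<open>\<mu> y > 0\<close> by simp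
  have quotient: "(N * (\<mu> y)\<^sup>2 - k * (2 * \<mu> y * d)) / ((\<mu> y)\<^sup>2 * (\<mu> y)\<^sup>2)
      = (\<mu> y * N - 2 * d * k) / (\<mu> y)^3" for N k d :: real
    using \<open>\<mu> y > 0\<close> by (simp add: divide_simps)
      (simp add: power2_eq_square power3_eq_cube power4_eq_xxxx algebra_simps)
  have "((\<lambda>y. (\<mu> y)\<^sup>2) has_derivative (\<lambda>u. 2 * \<mu> y * (2 * c * Re (hermitian u y)))) (at y)"
    by (rule derivative_eq_intros \<mu>' refl | simp add: mult_ac)+
  from has_derivative_divide'[OF n' this nz]
  have "((\<lambda>y. n y / (\<mu> y)\<^sup>2) has_derivative (\<lambda>u.
    (\<mu> y * Re (of_real (2 * c * Re (hermitian u y)) * hermitian v z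
      - of_real c * (hermitian v u * hermitian y z + hermitian v y * hermitian u z))
     - 2 * (2 * c * Re (hermitian u y)) * n y) / (\<mu> y)^3)) (at y)"
    by (simp only: quotient)
  moreover have "(\<lambda>y. cmet (M4_chart c i) y v z) = (\<lambda>y. n y / (\<mu> y)\<^sup>2)"
    by (simp add: M4_chart_def n_def \<mu>_def mult.assoc)
  ultimately show ?thesis
    by (simp add: n_def \<mu>_def m_def mult.assoc)
qed

text \<open>Complex lines of an affine chart are totally geodesic, so \<open>\<nabla>\<^sub>u u\<close> has to be a complex multiple of \<open>u\<close>;
  polarization suggests a combination of \<open>u\<close> and \<open>v\<close>, and the case of one complex dimension gives the
  coefficients. The Koszul formula confirms the guess, and determines the connection because the
  metric is definite.\<close>

lemma christoffel_M4_chart: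
  assumes "1 + c * (norm y)\<^sup>2 > 0"
  shows "christoffel (M4_chart c i) y u v =
    - (complex_of_real (c / (1 + c * (norm y)\<^sup>2))
        *s (hermitian u y *s v + hermitian v y *s u))"
    (is "_ = ?z")
proof -
  define m where "m = 1 + c * (norm y)\<^sup>2"
  have "m > 0" using assms by (simp add: m_def)
  let ?D = "\<lambda>a b. frechet_derivative (\<lambda>y. cmet (M4_chart c i) y a b) (at y)"
  have D: "?D a b d = (m * Re (2 * c * Re (hermitian d y) * hermitian a b
         - c * (hermitian a d * hermitian y b + hermitian a y * hermitian d b))
     - 4 * c * Re (hermitian d y) * Re (m * hermitian a b - c * hermitian a y * hermitian y b)) / m^3"
    for a b d
    using frechet_derivative_at[OF M4_chart_metric_has_derivative[OF assms], of a b i]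
    by (simp add: m_def fun_eq_iff)
  have koszul: "2 * cmet (M4_chart c i) y ?z w = ?D v w u + ?D u w v - ?D u v w" for w
  proof -
    define uy vy wy uv uw vw where "uy = hermitian u y" and "vy = hermitian v y"
      and "wy = hermitian w y" and "uv = hermitian u v" and "uw = hermitian u w"
      and "vw = hermitian v w"
    have sym: "hermitian y u = cnj uy" "hermitian y v = cnj vy" "hermitian y w = cnj wy"
      "hermitian v u = cnj uv" "hermitian w u = cnj uw" "hermitian w v = cnj vw"
      by (simp_all add: uy_def vy_def wy_def uv_def uw_def vw_def)
    note fold = sym uy_def[symmetric] vy_def[symmetric] wy_def[symmetric] uv_def[symmetric]
      uw_def[symmetric] vw_def[symmetric]
    define q where "q = complex_of_real (c / m)"
    have hz: "hermitian ?z w = - (q * (uy * vw + vy * uw))" "hermitian ?z y = - (q * (uy * vy + vy * uy))"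
      unfolding m_def[symmetric] q_def[symmetric] hermitian_simps fold by (rule refl)+
    have "of_real m * hermitian ?z w - of_real c * hermitian ?z y * hermitian y w
        = - q * (of_real m * (uy * vw + vy * uw) - of_real c * (2 * uy * vy * cnj wy))"
      unfolding hz sym by (simp add: algebra_simps)
    then have "2 * cmet (M4_chart c i) y ?z w =
        2 * Re (- q * (of_real m * (uy * vw + vy * uw)
          - of_real c * (2 * uy * vy * cnj wy))) / m\<^sup>2"
      unfolding M4_chart_def by (simp only: chart.simps m_def[symmetric] times_divide_eq_right)
    also have "\<dots> = - 2 * c * Re (of_real m * (uy * vw + vy * uw)
          - of_real c * (2 * uy * vy * cnj wy)) / m^3"
      using \<open>m > 0\<close> by (simp add: q_def field_simps power2_eq_square power3_eq_cube)
    also have "\<dots> = ?D v w u + ?D u w v - ?D u v w"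
      unfolding D fold add_divide_distrib[symmetric] diff_divide_distrib[symmetric]
      \<comment> \<open>After multiplication by \<open>m\<^sup>3\<close>, both sides are polynomials in \<open>m\<close> and the six Hermitian products.\<close>
      by (rule arg_cong[where f="\<lambda>t. t / m^3"]) (simp, algebra)
    finally show ?thesis .
  qed
  show ?thesis
    unfolding christoffel_def
  proof (rule the_equality)
    show "\<forall>w. 2 * cmet (M4_chart c i) y ?z w = ?D v w u + ?D u w v - ?D u v w"
      using koszul by blast
  next
    fix z
    assume z: "\<forall>w. 2 * cmet (M4_chart c i) y z w = ?D v w u + ?D u w v - ?D u v w"
    have "cmet (M4_chart c i) y z (z - ?z) = cmet (M4_chart c i) y ?z (z - ?z)"
      using koszul[of "z - ?z"] z[rule_format, of "z - ?z"] by linarith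
    then have "cmet (M4_chart c i) y (z - ?z) (z - ?z) = 0"
      unfolding M4_chart_metric_diff_left by linarith
    then have "z - ?z = 0" by (rule M4_chart_metric_definite[OF assms])
    then show "z = ?z" by (rule eq_iff_diff_eq_0[THEN iffD2])
  qed
qed

section \<open>Homogeneous coordinates\<close>

text \<open>The points of \<open>M\<^sup>4(c)\<close> are the lines on which this form is positive: every line for \<open>c > 0\<close>, the
  ones spanned by \<open>(1, z)\<close> with \<open>|z| < 1\<close> for \<open>c < 0\<close>.\<close>

definition hform :: "real \<Rightarrow> complex^3 \<Rightarrow> complex^3 \<Rightarrow> complex" where
  "hform c Z Y = Z$1 * cnj (Y$1) + of_real (sgn c) * (Z$2 * cnj (Y$2) + Z$3 * cnj (Y$3))"

text \<open>The order of the entries is the one in which \<open>affine_embedding\<close> places them.\<close>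

definition rest :: "3 \<Rightarrow> complex^3 \<Rightarrow> complex^2" where
  "rest i Z = (if i = 1 then vector [Z$2, Z$3] else if i = 2 then vector [Z$1, Z$3]
     else vector [Z$1, Z$2])"

definition affine_coord :: "real \<Rightarrow> 3 \<Rightarrow> complex^3 \<Rightarrow> complex^2" where
  "affine_coord c i Z = complex_of_real (inverse (sqrt \<bar>c\<bar>)) *s (inverse (Z$i) *s rest i Z)"

text \<open>The derivative of \<open>affine_coord c i\<close> at \<open>Z\<close>. It represents the vector \<open>A\<close>, modulo the line of \<open>Z\<close>, as a
  tangent vector of the complex space form at the line of \<open>Z\<close>.\<close>

definition affine_push :: "real \<Rightarrow> 3 \<Rightarrow> complex^3 \<Rightarrow> complex^3 \<Rightarrow> complex^2" where
  "affine_push c i Z A =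
     complex_of_real (inverse (sqrt \<bar>c\<bar>)) *s (inverse (Z$i) *s (rest i A - (A$i / Z$i) *s rest i Z))"

lemma hform_simps [simp]:
  "hform c (Z + Z') Y = hform c Z Y + hform c Z' Y"
  "hform c Z (Y + Y') = hform c Z Y + hform c Z Y'"
  "hform c (Z - Z') Y = hform c Z Y - hform c Z' Y"
  "hform c Z (Y - Y') = hform c Z Y - hform c Z Y'"
  "hform c (a *s Z) Y = a * hform c Z Y"
  "hform c Z (a *s Y) = cnj a * hform c Z Y"
  "hform c (r *\<^sub>R Z) Y = of_real r * hform c Z Y"
  "hform c Z (r *\<^sub>R Y) = of_real r * hform c Z Y"
  "hform c 0 Y = 0"
  "cnj (hform c Z Y) = hform c Y Z"
  by (simp_all add: hform_def algebra_simps scaleR_conv_of_real[where 'a=complex])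

lemma rest_simps [simp]:
  "rest i (Z + Z') = rest i Z + rest i Z'"
  "rest i (Z - Z') = rest i Z - rest i Z'"
  "rest i (a *s Z) = a *s rest i Z"
  "rest i (r *\<^sub>R Z) = r *\<^sub>R rest i Z"
  by (simp_all add: rest_def vec_eq_iff forall_2)

lemma bounded_linear_rest: "bounded_linear (rest i)"
  by (simp add: linear_iff flip: linear_conv_bounded_linear)

lemma three_cases: "(i :: 3) = 1 \<or> i = 2 \<or> i = 3"
  using exhaust_3 by blast

lemma rest_affine_embedding [simp]:
  "affine_embedding i z $ i = 1" "rest i (affine_embedding i z) = z"
  using three_cases[of i] by (auto simp: affine_embedding_def rest_def vec_eq_iff forall_2)

lemma split_eqI: "Z $ i = Y $ i \<Longrightarrow> rest i Z = rest i Y \<Longrightarrow> Z = Y"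
  using three_cases[of i] by (auto simp: rest_def vec_eq_iff forall_2 forall_3)

text \<open>For \<open>c > 0\<close> the form is symmetric in the three coordinates. For \<open>c < 0\<close> it distinguishes the first
  one, and the first affine chart is the only one of \<open>M4_space c\<close>.\<close>

lemma hform_split:
  assumes "c \<le> 0 \<longrightarrow> i = 1"
  shows "hform c Z Y = Z$i * cnj (Y$i) + of_real (sgn c) * hermitian (rest i Z) (rest i Y)"
  using assms three_cases[of i]
  by (cases "c \<le> 0") (auto simp: hform_def hermitian_def sum_2 rest_def)

lemma affine_push_simps [simp]:
  "affine_push c i Z (A + A') = affine_push c i Z A + affine_push c i Z A'"
  "affine_push c i Z (a *s A) = a *s affine_push c i Z A"
  "affine_push c i Z (r *\<^sub>R A) = r *\<^sub>R affine_push c i Z A"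
  by (simp_all add: affine_push_def vec_eq_iff algebra_simps add_divide_distrib
      scaleR_conv_of_real[where 'a=complex])

lemma affine_push_self: "Z$i \<noteq> 0 \<Longrightarrow> affine_push c i Z Z = 0"
  by (simp add: affine_push_def)

lemma affine_push_uminus [simp]: "affine_push c i Z (- A) = - affine_push c i Z A"
  using affine_push_simps(3)[of c i Z "-1" A] by simp

lemma affine_push_diff [simp]:
  "affine_push c i Z (A - A') = affine_push c i Z A - affine_push c i Z A'"
  using affine_push_simps(1)[of c i Z A "- A'"] by simp

lemma bounded_linear_affine_push: "bounded_linear (affine_push c i Z)"
  by (simp add: linear_iff flip: linear_conv_bounded_linear)

lemma has_derivative_inverse_component:
  fixes Z :: "complex^3"
  assumes "Z$i \<noteq> 0"
  shows "((\<lambda>Z. inverse (Z$i)) has_derivative (\<lambda>A. - (A$i / (Z$i)\<^sup>2))) (at Z)"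
  using Deriv.has_derivative_inverse[OF assms bounded_linear_imp_has_derivative[OF
        bounded_linear_vec_nth], of UNIV]
  by (simp add: power2_eq_square divide_inverse mult_ac)

lemmas has_derivative_vector_scalar_mult =
  bounded_bilinear.FDERIV[OF bounded_bilinear_vector_scalar_mult]

lemma affine_coord_has_derivative:
  assumes "Z$i \<noteq> 0"
  shows "(affine_coord c i has_derivative affine_push c i Z) (at Z)"
proof -
  note d = has_derivative_vector_scalar_mult[OF has_derivative_const
      has_derivative_vector_scalar_mult[OF has_derivative_inverse_component[OF assms]
        bounded_linear_imp_has_derivative[OF bounded_linear_rest]]]
  show ?thesis
    unfolding affine_coord_def[abs_def]
    by (rule has_derivative_eq_rhs[OF d])
      (use assms in \<open>simp add: fun_eq_iff affine_push_def vec_eq_iff field_simps power2_eq_square\<close>)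
qed

lemma affine_push_has_derivative:
  assumes "Z$i \<noteq> 0"
  shows "((\<lambda>Z. affine_push c i Z P) has_derivative
    (\<lambda>A. - ((A$i / Z$i) *s affine_push c i Z P) - (P$i / Z$i) *s affine_push c i Z A)) (at Z)"
proof -
  let ?s = "complex_of_real (inverse (sqrt \<bar>c\<bar>))"
  have eq: "(\<lambda>Z. affine_push c i Z P) =
     (\<lambda>Z. ?s *s (inverse (Z$i) *s (rest i P - P$i *s (inverse (Z$i) *s rest i Z))))"
    by (simp add: affine_push_def fun_eq_iff vec_eq_iff divide_inverse mult.assoc)
  note d = has_derivative_vector_scalar_mult[OF has_derivative_const
      has_derivative_vector_scalar_mult[OF has_derivative_inverse_component[OF assms]
        has_derivative_diff[OF has_derivative_const has_derivative_vector_scalar_mult[OF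
          has_derivative_const has_derivative_vector_scalar_mult[OF
            has_derivative_inverse_component[OF assms]
        bounded_linear_imp_has_derivative[OF bounded_linear_rest]]]]]]
  show ?thesis
    unfolding eq
    by (rule has_derivative_eq_rhs[OF d])
      (use assms in \<open>simp add: fun_eq_iff affine_push_def vec_eq_iff field_simps power2_eq_square\<close>)
qed

lemma of_real_sgn: "complex_of_real c * (of_real (inverse (sqrt \<bar>c\<bar>)) * of_real (inverse (sqrt \<bar>c\<bar>)))
    = of_real (sgn c)"
proof -
  have "inverse (sqrt \<bar>c\<bar>) * inverse (sqrt \<bar>c\<bar>) = inverse \<bar>c\<bar>"
    by (simp flip: inverse_mult_distrib)
  then have "c * (inverse (sqrt \<bar>c\<bar>) * inverse (sqrt \<bar>c\<bar>)) = sgn c"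
    by (simp only:) (simp add: sgn_if abs_if)
  then show ?thesis
    by (simp only: of_real_mult[symmetric])
qed

text \<open>Subtracting a multiple of \<open>Z\<close> from \<open>A\<close> makes its \<open>i\<close>-th entry vanish and does not change its image in
  the chart. On vectors with vanishing \<open>i\<close>-th entry, the form is the Hermitian product of the images
  up to the factors \<open>c\<close> and \<open>|Z$i|\<^sup>2\<close>.\<close>

lemma hermitian_affine_push:
  assumes i: "c \<le> 0 \<longrightarrow> i = 1" and Z: "Z$i \<noteq> 0"
  shows "of_real c * hermitian (affine_push c i Z A) (affine_push c i Z B) =
    hform c (A - (A$i / Z$i) *s Z) (B - (B$i / Z$i) *s Z) / (Z$i * cnj (Z$i))"
proof -
  let ?A = "A - (A$i / Z$i) *s Z" and ?B = "B - (B$i / Z$i) *s Z"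
  let ?s = "complex_of_real (inverse (sqrt \<bar>c\<bar>))"
  have "?A$i = 0" using Z by simp
  then have h: "hform c ?A ?B = of_real (sgn c) * hermitian (rest i ?A) (rest i ?B)"
    unfolding hform_split[OF i] by (simp only: mult_zero_left add_0_left)
  have p: "affine_push c i Z A = ?s *s (inverse (Z$i) *s rest i ?A)"
    "affine_push c i Z B = ?s *s (inverse (Z$i) *s rest i ?B)"
    by (simp_all add: affine_push_def)
  have "of_real c * hermitian (affine_push c i Z A) (affine_push c i Z B)
     = (of_real c * (?s * ?s)) * (hermitian (rest i ?A) (rest i ?B) * inverse (Z$i) * cnj (inverse (Z$i)))"
    unfolding p hermitian_simps(7,8) by simp
  then show ?thesis
    unfolding of_real_sgn h
    by (simp only: divide_inverse inverse_mult_distrib complex_cnj_inverse mult_ac)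
qed

lemma hermitian_affine_coord:
  assumes i: "c \<le> 0 \<longrightarrow> i = 1" and Z: "Z$i \<noteq> 0"
  shows "of_real c * hermitian (affine_push c i Z A) (affine_coord c i Z) =
    hform c (A - (A$i / Z$i) *s Z) Z / (Z$i * cnj (Z$i))"
proof -
  let ?A = "A - (A$i / Z$i) *s Z"
  let ?s = "complex_of_real (inverse (sqrt \<bar>c\<bar>))"
  have "?A$i = 0" using Z by simp
  then have h: "hform c ?A Z = of_real (sgn c) * hermitian (rest i ?A) (rest i Z)"
    unfolding hform_split[OF i] by (simp only: mult_zero_left add_0_left)
  have p: "affine_push c i Z A = ?s *s (inverse (Z$i) *s rest i ?A)"
    by (simp_all add: affine_push_def)
  have "of_real c * hermitian (affine_push c i Z A) (affine_coord c i Z)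
     = (of_real c * (?s * ?s)) * (hermitian (rest i ?A) (rest i Z) * inverse (Z$i) * cnj (inverse (Z$i)))"
    unfolding p affine_coord_def hermitian_simps(7,8) by simp
  then show ?thesis
    unfolding of_real_sgn h
    by (simp only: divide_inverse inverse_mult_distrib complex_cnj_inverse mult_ac)
qed

lemma norm_affine_coord:
  assumes i: "c \<le> 0 \<longrightarrow> i = 1" and Z: "Z$i \<noteq> 0"
  shows "complex_of_real (1 + c * (norm (affine_coord c i Z))\<^sup>2) =
    hform c Z Z / (Z$i * cnj (Z$i))"
proof -
  let ?s = "complex_of_real (inverse (sqrt \<bar>c\<bar>))"
  have "complex_of_real (c * (norm (affine_coord c i Z))\<^sup>2)
     = of_real c * hermitian (affine_coord c i Z) (affine_coord c i Z)"
    by (simp add: hermitian_self)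
  also have "\<dots> = (of_real c * (?s * ?s)) * (hermitian (rest i Z) (rest i Z) * inverse (Z$i) * cnj (inverse (Z$i)))"
    unfolding affine_coord_def hermitian_simps(7,8) by simp
  finally show ?thesis
    using Z unfolding of_real_sgn hform_split[OF i] by (simp add: field_simps)
qed

lemma hform_self_real: "hform c Z Z = of_real (Re (hform c Z Z))"
  by (simp add: hform_def complex_eq_iff)

lemma affine_coord_pos:
  assumes "c \<le> 0 \<longrightarrow> i = 1" and "Z$i \<noteq> 0" and "Re (hform c Z Z) > 0"
  shows "1 + c * (norm (affine_coord c i Z))\<^sup>2 > 0"
proof -
  have "Z$i * cnj (Z$i) = of_real ((cmod (Z$i))\<^sup>2)"
    by (metis complex_norm_square)
  then have "1 + c * (norm (affine_coord c i Z))\<^sup>2 = Re (hform c Z Z) / (cmod (Z$i))\<^sup>2"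
    using norm_affine_coord[OF assms(1,2)] hform_self_real[of c Z]
    by (metis of_real_divide of_real_eq_iff)
  then show ?thesis using assms(2,3) by simp
qed

text \<open>The metric of the complex space form in homogeneous coordinates. The right-hand side does not
  change when multiples of \<open>Z\<close> are added to \<open>A\<close> or \<open>B\<close>, which is why the chart can be eliminated.\<close>

lemma M4_metric_affine_push:
  assumes i: "c \<le> 0 \<longrightarrow> i = 1" and Z: "Z$i \<noteq> 0" and pos: "Re (hform c Z Z) > 0" and c: "c \<noteq> 0"
  shows "cmet (M4_chart c i) (affine_coord c i Z) (affine_push c i Z A) (affine_push c i Z B) =
    Re (hform c Z Z * hform c A B - hform c A Z * hform c Z B) / (c * (Re (hform c Z Z))\<^sup>2)"
proof -
  let ?w = "affine_coord c i Z" and ?A = "affine_push c i Z A" and ?B = "affine_push c i Z B"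
  define n where "n = (cmod (Z$i))\<^sup>2"
  define M where "M = Re (hform c Z Z)"
  have M: "hform c Z Z = of_real M" using hform_self_real M_def by simp
  have n: "Z$i * cnj (Z$i) = of_real n" unfolding n_def by (metis complex_norm_square)
  have "n > 0" "M > 0" using Z pos by (simp_all add: n_def M_def)
  have mu: "complex_of_real (1 + c * (norm ?w)\<^sup>2) = of_real (M / n)"
    using norm_affine_coord[OF i Z] by (simp add: n M)
  then have mu': "1 + c * (norm ?w)\<^sup>2 = M / n" by (simp only: of_real_eq_iff)
  define t s where "t = A$i / Z$i" and "s = B$i / Z$i"
  define HAB HAZ HZB where "HAB = hform c A B" and "HAZ = hform c A Z" and "HZB = hform c Z B"
  have AB: "of_real c * hermitian ?A ?B
      = (HAB - t * HZB - cnj s * HAZ + t * cnj s * of_real M) / of_real n"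
    unfolding hermitian_affine_push[OF i Z] n t_def[symmetric] s_def[symmetric]
    by (simp add: M HAB_def HZB_def HAZ_def algebra_simps)
  have Aw: "of_real c * hermitian ?A ?w = (HAZ - t * of_real M) / of_real n"
    unfolding hermitian_affine_coord[OF i Z] n
    by (simp add: M HAZ_def t_def)
  have "of_real c * hermitian ?w ?B = cnj (of_real c * hermitian ?B ?w)" by simp
  also have "\<dots> = (HZB - cnj s * of_real M) / of_real n"
    unfolding hermitian_affine_coord[OF i Z] n
    by (simp add: M HZB_def s_def)
  finally have wB: "of_real c * hermitian ?w ?B = (HZB - cnj s * of_real M) / of_real n" .
  define X where "X = of_real (M / n) * hermitian ?A ?B - of_real c * hermitian ?A ?w * hermitian ?w ?B"
  have "of_real c * X = of_real (M / n) * (of_real c * hermitian ?A ?B)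
     - (of_real c * hermitian ?A ?w) * (of_real c * hermitian ?w ?B)"
    by (simp add: X_def algebra_simps)
  also have "\<dots> = (of_real M * HAB - HAZ * HZB) / (of_real n)\<^sup>2"
    unfolding AB Aw wB using \<open>n > 0\<close> by (simp add: field_simps power2_eq_square)
  finally have cX: "of_real c * X = (of_real M * HAB - HAZ * HZB) / of_real (n\<^sup>2)" by simp
  have "c * Re X = Re (of_real c * X)" by simp
  also have "\<dots> = Re (of_real M * HAB - HAZ * HZB) / n\<^sup>2"
    unfolding cX by (rule Re_divide_of_real)
  finally have cX: "c * Re X = Re (of_real M * HAB - HAZ * HZB) / n\<^sup>2" .
  have "cmet (M4_chart c i) ?w ?A ?B = Re X / (M / n)\<^sup>2"
    unfolding M4_chart_def by (simp only: chart.simps mu' X_def)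
  also have "\<dots> = (c * Re X) * n\<^sup>2 / (c * M\<^sup>2)"
    using \<open>n > 0\<close> \<open>M > 0\<close> c by (simp add: field_simps power2_eq_square)
  also have "\<dots> = Re (of_real M * HAB - HAZ * HZB) / (c * M\<^sup>2)"
    unfolding cX using \<open>n > 0\<close> by simp
  finally show ?thesis unfolding M M_def[symmetric] HAB_def HAZ_def HZB_def by simp
qed

text \<open>The first two terms are the negative of the derivative of \<open>Z \<mapsto> affine_push c i Z P\<close> in the direction
  \<open>A\<close>, by \<open>affine_push_has_derivative\<close>. Hence the covariant derivative of the field represented by a
  constant vector \<open>P\<close> is given by the last term alone.\<close>

lemma christoffel_affine_push:
  assumes i: "c \<le> 0 \<longrightarrow> i = 1" and Z: "Z$i \<noteq> 0" and pos: "Re (hform c Z Z) > 0"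
  shows "christoffel (M4_chart c i) (affine_coord c i Z) (affine_push c i Z A) (affine_push c i Z P) =
    (A$i / Z$i) *s affine_push c i Z P + (P$i / Z$i) *s affine_push c i Z A
    - affine_push c i Z ((hform c A Z / hform c Z Z) *s P + (hform c P Z / hform c Z Z) *s A)"
proof -
  let ?w = "affine_coord c i Z"
  define m where "m = 1 + c * (norm ?w)\<^sup>2"
  have nz: "hform c Z Z \<noteq> 0" using pos by auto
  have m: "of_real m = hform c Z Z / (Z$i * cnj (Z$i))"
    unfolding m_def by (rule norm_affine_coord[OF i Z])
  have q: "of_real (c / m) * hermitian (affine_push c i Z B) ?w = hform c B Z / hform c Z Z - B$i / Z$i"
    for B
  proof -
    have "of_real (c / m) * hermitian (affine_push c i Z B) ?w
      = (of_real c * hermitian (affine_push c i Z B) ?w) / of_real m" by simp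
    also have "\<dots> = (hform c B Z - (B$i / Z$i) * hform c Z Z) / hform c Z Z"
      unfolding hermitian_affine_coord[OF i Z] m using Z by simp
    finally show ?thesis using nz by (simp add: diff_divide_distrib)
  qed
  have "christoffel (M4_chart c i) ?w (affine_push c i Z A) (affine_push c i Z P) =
    - ((of_real (c / m) * hermitian (affine_push c i Z A) ?w) *s affine_push c i Z P
     + (of_real (c / m) * hermitian (affine_push c i Z P) ?w) *s affine_push c i Z A)"
    unfolding christoffel_M4_chart[OF affine_coord_pos[OF i Z pos]] m_def
    by (simp add: vec_eq_iff algebra_simps)
  then show ?thesis
    unfolding q by (simp add: vec_eq_iff algebra_simps)
qed

section \<open>Complex lines in affine charts\<close>

lemma complex_line_eqD: "complex_line Z = complex_line Y \<Longrightarrow> \<exists>a. Z = a *s Y"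
  using range_eqI[of Z "\<lambda>a. a *s Z" 1] by (auto simp: complex_line_def)

lemma complex_line_scale:
  assumes "a \<noteq> 0"
  shows "complex_line (a *s Z) = complex_line Z"
proof (intro equalityI subsetI)
  fix Y assume "Y \<in> complex_line (a *s Z)"
  then show "Y \<in> complex_line Z"
    by (auto simp: complex_line_def vector_smult_assoc)
next
  fix Y assume "Y \<in> complex_line Z"
  then obtain b where "Y = b *s Z" by (auto simp: complex_line_def)
  then have "Y = (b / a) *s (a *s Z)" using assms by (simp add: vector_smult_assoc)
  then show "Y \<in> complex_line (a *s Z)" unfolding complex_line_def by (rule range_eqI)
qed

lemma affine_embedding_affine_coord:
  assumes "c \<noteq> 0" and "Z$i \<noteq> 0"
  shows "affine_embedding i (sqrt \<bar>c\<bar> *\<^sub>R affine_coord c i Z) = inverse (Z$i) *s Z"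
  by (rule split_eqI[where i=i])
    (use assms in \<open>simp_all add: affine_coord_def vec_eq_iff scaleR_conv_of_real[where 'a=complex]\<close>)

lemma inj_on_M4_chart:
  assumes "c \<noteq> 0"
  shows "inj_on (cpar (M4_chart c i)) (cdom (M4_chart c i))"
proof (rule inj_onI)
  fix w w'
  assume "cpar (M4_chart c i) w = cpar (M4_chart c i) w'"
  then obtain a where a: "affine_embedding i (sqrt \<bar>c\<bar> *\<^sub>R w) = a *s affine_embedding i (sqrt \<bar>c\<bar> *\<^sub>R w')"
    by (auto simp: M4_chart_def dest: complex_line_eqD)
  from arg_cong[OF a, of "\<lambda>Z. Z$i"] have "a = 1" by simp
  with arg_cong[OF a, of "rest i"] show "w = w'" using assms by simp
qed

lemma complex_line_in_chart:
  assumes "c \<noteq> 0" and "c \<le> 0 \<longrightarrow> i = 1" and "Z$i \<noteq> 0" and "Re (hform c Z Z) > 0"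
  shows "complex_line Z \<in> cimage (M4_chart c i)"
    and "coord (M4_chart c i) (complex_line Z) = affine_coord c i Z"
proof -
  have dom: "affine_coord c i Z \<in> cdom (M4_chart c i)"
    using affine_coord_pos[OF assms(2-4)] by (simp add: M4_chart_def)
  have par: "cpar (M4_chart c i) (affine_coord c i Z) = complex_line Z"
    using assms(3)
    by (simp add: M4_chart_def affine_embedding_affine_coord[OF assms(1,3)] complex_line_scale)
  show "complex_line Z \<in> cimage (M4_chart c i)"
    using dom par unfolding cimage_def by (metis imageI)
  show "coord (M4_chart c i) (complex_line Z) = affine_coord c i Z"
    unfolding coord_def by (rule the_inv_into_f_eq[OF inj_on_M4_chart[OF assms(1)] par dom])
qed

lemma complex_line_in_chartD:
  assumes "complex_line Z \<in> cimage (M4_chart c i)"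
  shows "Z$i \<noteq> 0"
proof
  assume "Z$i = 0"
  from assms obtain w where "complex_line (affine_embedding i w) = complex_line Z"
    by (auto simp: cimage_def M4_chart_def)
  then obtain a where "affine_embedding i w = a *s Z" by (blast dest: complex_line_eqD)
  from arg_cong[OF this, of "\<lambda>Z. Z$i"] show False using \<open>Z$i = 0\<close> by simp
qed

lemma M4_chart_index_unique:
  assumes "M4_chart c i = M4_chart c j"
  shows "i = j"
proof -
  have "cpar (M4_chart c i) 0 = cpar (M4_chart c j) 0" using assms by simp
  then obtain a where a: "affine_embedding i 0 = a *s affine_embedding j 0"
    by (auto simp: M4_chart_def dest: complex_line_eqD)
  from arg_cong[OF a, of "\<lambda>Z. Z$i"] have "affine_embedding j 0 $ i \<noteq> 0" by auto
  then show ?thesis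
    using three_cases[of i] three_cases[of j] by (auto simp: affine_embedding_def)
qed

text \<open>A vector field along a map receives the chart as a value, from which the index has to be recovered.\<close>

definition chart_index :: "real \<Rightarrow> (complex^2, (complex^3) set) chart \<Rightarrow> 3" where
  "chart_index c Q = (THE i. Q = M4_chart c i)"

lemma chart_index [simp]: "chart_index c (M4_chart c i) = i"
  unfolding chart_index_def using M4_chart_index_unique by blast

lemma M4_space_cases:
  assumes "c \<noteq> 0" and "Q \<in> M4_space c"
  obtains i where "Q = M4_chart c i" and "c \<le> 0 \<longrightarrow> i = 1"
  using assms by (auto simp: M4_space_def split: if_splits)

lemma complex_line_in_M4_space:
  assumes "c \<noteq> 0" and "Re (hform c Z Z) > 0"
  shows "complex_line Z \<in> points (M4_space c)"
proof (cases "c < 0")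
  case True
  then have "Re (hform c Z Z) = (cmod (Z$1))\<^sup>2 - (cmod (Z$2))\<^sup>2 - (cmod (Z$3))\<^sup>2"
    by (simp add: hform_def cmod_power2) (simp add: power2_eq_square)
  then have "(cmod (Z$1))\<^sup>2 > 0"
    using assms(2) zero_le_power2[of "cmod (Z$2)"] zero_le_power2[of "cmod (Z$3)"] by linarith
  then have "Z$1 \<noteq> 0" by auto
  then show ?thesis
    using True complex_line_in_chart(1)[of c 1 Z] assms by (simp add: points_def M4_space_def)
next
  case False
  have "\<exists>i. Z$i \<noteq> 0"
  proof (rule ccontr)
    assume "\<nexists>i. Z$i \<noteq> 0"
    then have "hform c Z Z = 0" by (simp add: hform_def)
    then show False using assms(2) by simp
  qed
  then show ?thesis
    using False complex_line_in_chart(1)[of c _ Z] assms by (auto simp: points_def M4_space_def)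
qed

lemma affine_push_scale: "a \<noteq> 0 \<Longrightarrow> affine_push c i (a *s Z) (a *s A) = affine_push c i Z A"
  by (simp add: affine_push_def vec_eq_iff field_simps)

lemma affine_push_shift: "Z$i \<noteq> 0 \<Longrightarrow> affine_push c i Z (A - t *s Z) = affine_push c i Z A"
  by (simp add: affine_push_self)

text \<open>Passing from chart \<open>i\<close> to chart \<open>j\<close> through \<open>\<complex>\<^sup>3\<close> replaces \<open>Z\<close> by \<open>Z / Z$i\<close> and \<open>A\<close> by
  \<open>(A - (A$i / Z$i) Z) / Z$i\<close>, and \<open>affine_push c j\<close> sees neither a common scaling of \<open>Z\<close> and \<open>A\<close> nor the
  addition of a multiple of \<open>Z\<close>. So a vector of \<open>\<complex>\<^sup>3\<close> represents the same tangent vector in all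
  charts.\<close>

lemma affine_push_change_of_charts:
  assumes c: "c \<noteq> 0" and i: "c \<le> 0 \<longrightarrow> i = 1" and j: "c \<le> 0 \<longrightarrow> j = 1"
    and Z: "Z$i \<noteq> 0" "Z$j \<noteq> 0" and pos: "Re (hform c Z Z) > 0"
  shows "drep id (M4_chart c i) (M4_chart c j) (affine_coord c i Z) (affine_push c i Z A)
    = affine_push c j Z A"
proof -
  define emb where "emb = (\<lambda>w. affine_embedding i (sqrt \<bar>c\<bar> *\<^sub>R w))"
  define L where "L = (\<lambda>w. emb w - emb 0)"
  have L: "L w $ i = 0" "rest i (L w) = sqrt \<bar>c\<bar> *\<^sub>R w" for w
    by (simp_all add: L_def emb_def)
  have "linear L"
    by (rule linearI) (rule split_eqI[where i=i]; simp add: L algebra_simps)+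
  then have bL: "bounded_linear L" by (simp add: linear_conv_bounded_linear)
  have emb_eq: "emb = (\<lambda>w. L w + emb 0)" by (simp add: L_def)
  have emb': "(emb has_derivative L) (at w)" for w
    by (subst emb_eq)
      (use has_derivative_add[OF bounded_linear_imp_has_derivative[OF bL] has_derivative_const]
        in simp)
  let ?w = "affine_coord c i Z"
  have w: "emb ?w = inverse (Z$i) *s Z"
    unfolding emb_def by (rule affine_embedding_affine_coord[OF c Z(1)])
  define U where "U = {w. emb w $ j \<noteq> 0 \<and> 1 + c * (norm w)\<^sup>2 > 0}"
  have cont: "continuous_on UNIV emb"
    using emb' has_derivative_continuous continuous_at_imp_continuous_on by blast
  have "open U"
    unfolding U_def
    by (intro open_Collect_conj open_Collect_neq open_Collect_less continuous_intros cont)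
  moreover have "?w \<in> U"
    using affine_coord_pos[OF i Z(1) pos] Z by (simp add: U_def w)
  moreover have "affine_coord c j (emb w) = rep id (M4_chart c i) (M4_chart c j) w" if "w \<in> U" for w
  proof -
    have "hform c (emb w) (emb w) = of_real (1 + c * (norm w)\<^sup>2)"
    proof -
      have "sgn c * (norm (sqrt \<bar>c\<bar> *\<^sub>R w))\<^sup>2 = c * (norm w)\<^sup>2"
        by (simp add: power_mult_distrib sgn_mult_abs flip: mult.assoc)
      then show ?thesis
        unfolding hform_split[OF i] emb_def rest_affine_embedding hermitian_self
        by (simp only: of_real_mult[symmetric] of_real_add of_real_1) simp
    qed
    then have "Re (hform c (emb w) (emb w)) > 0" using that by (simp add: U_def)
    moreover have "emb w $ j \<noteq> 0" using that by (simp add: U_def)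
    ultimately show ?thesis
      using complex_line_in_chart(2)[OF c j]
      by (simp add: rep_def M4_chart_def emb_def)
  qed
  moreover have "((\<lambda>w. affine_coord c j (emb w)) has_derivative
      (\<lambda>v. affine_push c j (emb ?w) (L v))) (at ?w)"
    using Z by (intro has_derivative_compose[OF emb' affine_coord_has_derivative]) (simp add: w)
  ultimately have "(rep id (M4_chart c i) (M4_chart c j) has_derivative
      (\<lambda>v. affine_push c j (emb ?w) (L v))) (at ?w)"
    by (rule has_derivative_transform_within_open[rotated 1])
  then have "drep id (M4_chart c i) (M4_chart c j) ?w v = affine_push c j (emb ?w) (L v)" for v
    unfolding drep_def by (simp add: frechet_derivative_at[symmetric])
  moreover have "L (affine_push c i Z A) = inverse (Z$i) *s (A - (A$i / Z$i) *s Z)"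
  proof (rule split_eqI[where i=i])
    have "sqrt \<bar>c\<bar> *\<^sub>R (complex_of_real (inverse (sqrt \<bar>c\<bar>)) *s X) = X" for X :: "complex^2"
      using c by (simp add: vec_eq_iff scaleR_conv_of_real[where 'a=complex])
    then show "rest i (L (affine_push c i Z A)) = rest i (inverse (Z$i) *s (A - (A$i / Z$i) *s Z))"
      unfolding L rest_simps affine_push_def by (simp only:)
  qed (use Z in \<open>simp add: L\<close>)
  ultimately show ?thesis
    using affine_push_scale[OF nonzero_imp_inverse_nonzero[OF Z(1)]]
    by (simp only: w affine_push_shift[OF Z(2)])
qed

section \<open>Level sets of the distance to a pole\<close>

definition lift_derivative ::
  "('p \<Rightarrow> complex^3) \<Rightarrow> ('d::euclidean_space, 'p) chart \<Rightarrow> 'd \<Rightarrow> 'd \<Rightarrow> complex^3" where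
  "lift_derivative F P x = frechet_derivative (\<lambda>x. F (cpar P x)) (at x)"

text \<open>The image of \<open>E\<close> lies in the level set \<open>|\<langle>pole, Z\<rangle>|\<^sup>2 / \<langle>Z, Z\<rangle> = m\<^sup>2 / k\<close>, and the lift \<open>F\<close> is
  normalized so that \<open>\<langle>F, F\<rangle>\<close> and \<open>\<langle>pole, F\<rangle>\<close> are constant separately. Divided by
  \<open>k\<close>, the imaginary number \<open>\<langle>dF u, F\<rangle>\<close> is the connection form of the fibration \<open>Z \<mapsto> complex_line Z\<close>,
  pulled back by \<open>F\<close>; it is required to be a multiple of \<open>\<eta>\<close>, whereas \<open>lift_vertical\<close> says that along the
  fibers of \<open>E\<close> the lift moves in the direction \<open>\<i> pole\<close>, modulo its own line. The
  equation \<open>lift_metric\<close> is the isometry condition in homogeneous coordinates, and \<open>normal_scale\<close> makes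
  \<open>\<nu> pole\<close> represent a unit vector.\<close>

locale pole_lift =
  fixes c k m \<rho> \<delta> \<delta>' \<nu> :: real
    and E :: "('d::euclidean_space, 'p) chart set"
    and F :: "'p \<Rightarrow> complex^3" and pole :: "complex^3"
    and \<xi> :: "('d, 'p) chart \<Rightarrow> 'd \<Rightarrow> 'd"
  assumes c_nonzero: "c \<noteq> 0" and k_pos: "k > 0" and \<rho>_nonzero: "\<rho> \<noteq> 0" and \<delta>_nonzero: "\<delta> \<noteq> 0"
    and lift_smooth: "\<And>P. P \<in> E \<Longrightarrow> C_infinity_on (\<lambda>x. F (cpar P x)) (cdom P)"
    and lift_norm: "\<And>P x. P \<in> E \<Longrightarrow> x \<in> cdom P \<Longrightarrow>
      hform c (F (cpar P x)) (F (cpar P x)) = of_real k"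
    and lift_pole: "\<And>P x. P \<in> E \<Longrightarrow> x \<in> cdom P \<Longrightarrow> hform c pole (F (cpar P x)) = of_real m"
    and lift_contact: "\<And>P x u. P \<in> E \<Longrightarrow> x \<in> cdom P \<Longrightarrow>
      hform c (lift_derivative F P x u) (F (cpar P x)) = \<i> * of_real (\<rho> * cmet P x (\<xi> P x) u)"
    and lift_metric: "\<And>P x u v. P \<in> E \<Longrightarrow> x \<in> cdom P \<Longrightarrow>
      Re (hform c (lift_derivative F P x u) (lift_derivative F P x v)) / k
        - \<rho>\<^sup>2 * cmet P x (\<xi> P x) u * cmet P x (\<xi> P x) v / k\<^sup>2 = c * cmet P x u v"
    and lift_vertical: "\<And>P x. P \<in> E \<Longrightarrow> x \<in> cdom P \<Longrightarrow>
      lift_derivative F P x (\<xi> P x) = \<i> *s (\<delta> *\<^sub>R pole + \<delta>' *\<^sub>R F (cpar P x))"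
    and metric_definite: "\<And>P x u. P \<in> E \<Longrightarrow> x \<in> cdom P \<Longrightarrow> cmet P x u u = 0 \<Longrightarrow> u = 0"
    and vertical_unit: "\<And>P x. P \<in> E \<Longrightarrow> x \<in> cdom P \<Longrightarrow> cmet P x (\<xi> P x) (\<xi> P x) = 1"
    and normal_scale: "\<nu>\<^sup>2 * (k * Re (hform c pole pole) - m\<^sup>2) = c * k\<^sup>2"
begin

definition immersion :: "'p \<Rightarrow> (complex^3) set" where
  "immersion p = complex_line (F p)"

definition normal :: "(complex^2, (complex^3) set) chart \<Rightarrow> 'p \<Rightarrow> complex^2" where
  "normal Q p = affine_push c (chart_index c Q) (F p) (\<nu> *\<^sub>R pole)"

context
  fixes P :: "('d, 'p) chart" and i :: 3
  assumes P: "P \<in> E" and i: "c \<le> 0 \<longrightarrow> i = 1"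
begin

lemma lift_has_derivative:
  "x \<in> cdom P \<Longrightarrow> ((\<lambda>x. F (cpar P x)) has_derivative lift_derivative F P x) (at x)"
  unfolding lift_derivative_def by (rule C_infinity_on_has_derivative[OF lift_smooth[OF P]])

lemma open_domain: "open (cdom P)"
  using lift_smooth[OF P] by (simp add: C_infinity_on_def)

lemma lift_positive: "x \<in> cdom P \<Longrightarrow> Re (hform c (F (cpar P x)) (F (cpar P x))) > 0"
  by (simp add: lift_norm[OF P] k_pos)

lemma rep_dom_immersion:
  "rep_dom immersion P (M4_chart c i) = {x \<in> cdom P. F (cpar P x) $ i \<noteq> 0}"
  using complex_line_in_chart(1)[OF c_nonzero i] complex_line_in_chartD lift_positive
  by (auto simp: rep_dom_def immersion_def)

lemma open_rep_dom: "open (rep_dom immersion P (M4_chart c i))"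
proof -
  have "continuous_on (cdom P) (\<lambda>x. F (cpar P x))"
    using lift_smooth[OF P] C_k_on.simps(1) unfolding C_infinity_on_def by metis
  then have "continuous_on (cdom P) (\<lambda>x. F (cpar P x) $ i)" by (intro continuous_intros)
  then have "open ((\<lambda>x. F (cpar P x) $ i) -` (- {0}) \<inter> cdom P)"
    using continuous_on_open_vimage[OF open_domain] open_Compl[OF closed_singleton] by blast
  moreover have "(\<lambda>x. F (cpar P x) $ i) -` (- {0}) \<inter> cdom P = rep_dom immersion P (M4_chart c i)"
    unfolding rep_dom_immersion by auto
  ultimately show ?thesis by simp
qed

lemma rep_immersion:
  "x \<in> rep_dom immersion P (M4_chart c i) \<Longrightarrow>
    rep immersion P (M4_chart c i) x = affine_coord c i (F (cpar P x))"
  unfolding rep_dom_immersion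
  by (simp add: rep_def immersion_def complex_line_in_chart(2)[OF c_nonzero i] lift_positive)

lemma drep_immersion:
  assumes x: "x \<in> rep_dom immersion P (M4_chart c i)"
  shows "drep immersion P (M4_chart c i) x u =
    affine_push c i (F (cpar P x)) (lift_derivative F P x u)"
proof -
  have x': "x \<in> cdom P" "F (cpar P x) $ i \<noteq> 0" using x by (auto simp: rep_dom_immersion)
  have "(rep immersion P (M4_chart c i) has_derivative
      (\<lambda>u. affine_push c i (F (cpar P x)) (lift_derivative F P x u))) (at x)"
    by (rule has_derivative_transform_within_open[OF has_derivative_compose[OF
          lift_has_derivative[OF x'(1)] affine_coord_has_derivative[OF x'(2)]] open_rep_dom x])
      (simp add: rep_immersion)
  then show ?thesis unfolding drep_def by (simp add: frechet_derivative_at[symmetric])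
qed

lemma C_k_on_lift_rep_dom: "C_k_on n (\<lambda>x. F (cpar P x)) (rep_dom immersion P (M4_chart c i))"
  by (rule C_k_on_mono_set[of _ "cdom P"])
    (use lift_smooth[OF P] in \<open>auto simp: C_infinity_on_def rep_dom_immersion\<close>)

lemma C_k_on_inverse_component:
  "C_k_on n (\<lambda>x. inverse (F (cpar P x) $ i)) (rep_dom immersion P (M4_chart c i))"
  by (intro C_k_on_inverse open_rep_dom C_k_on_bounded_linear[OF open_rep_dom bounded_linear_vec_nth]
      C_k_on_lift_rep_dom) (simp add: rep_dom_immersion)

lemma rep_immersion_smooth:
  "C_infinity_on (rep immersion P (M4_chart c i)) (rep_dom immersion P (M4_chart c i))"
proof (rule C_infinity_on_cong[OF C_infinity_onI rep_immersion])
  show "C_k_on n (\<lambda>x. affine_coord c i (F (cpar P x))) (rep_dom immersion P (M4_chart c i))" for n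
    unfolding affine_coord_def
    by (intro C_k_on_vector_scalar_mult C_k_on_const open_rep_dom C_k_on_inverse_component
        C_k_on_bounded_linear[OF open_rep_dom bounded_linear_rest] C_k_on_lift_rep_dom)
qed (auto intro: open_rep_dom)

lemma normal_smooth:
  "C_infinity_on (\<lambda>x. normal (M4_chart c i) (cpar P x)) (rep_dom immersion P (M4_chart c i))"
proof (rule C_infinity_onI[OF open_rep_dom])
  let ?s = "complex_of_real (inverse (sqrt \<bar>c\<bar>))"
  have "normal (M4_chart c i) p = ?s *s (inverse (F p $ i) *s
      (rest i (\<nu> *\<^sub>R pole) + ((- (\<nu> *\<^sub>R pole) $ i) * inverse (F p $ i)) *s rest i (F p)))" for p
    by (simp add: normal_def affine_push_def vec_eq_iff divide_inverse)
  then show "C_k_on n (\<lambda>x. normal (M4_chart c i) (cpar P x)) (rep_dom immersion P (M4_chart c i))" for n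
    by (simp only:) (intro C_k_on_vector_scalar_mult C_k_on_const open_rep_dom
        C_k_on_inverse_component C_k_on_add C_k_on_mult C_k_on_lift_rep_dom
        C_k_on_bounded_linear[OF open_rep_dom bounded_linear_rest])
qed

lemma immersion_isometric:
  assumes x: "x \<in> rep_dom immersion P (M4_chart c i)"
  shows "cmet (M4_chart c i) (rep immersion P (M4_chart c i) x)
    (drep immersion P (M4_chart c i) x u) (drep immersion P (M4_chart c i) x v) = cmet P x u v"
proof -
  have x': "x \<in> cdom P" "F (cpar P x) $ i \<noteq> 0" using x by (auto simp: rep_dom_immersion)
  let ?Z = "F (cpar P x)" and ?A = "lift_derivative F P x"
  have "hform c ?Z (?A v) = cnj (hform c (?A v) ?Z)" by simp
  also have "\<dots> = - \<i> * of_real (\<rho> * cmet P x (\<xi> P x) v)"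
    unfolding lift_contact[OF P x'(1)] by simp
  finally have Zv: "hform c ?Z (?A v) = - \<i> * of_real (\<rho> * cmet P x (\<xi> P x) v)" .
  have "cmet (M4_chart c i) (rep immersion P (M4_chart c i) x)
    (drep immersion P (M4_chart c i) x u) (drep immersion P (M4_chart c i) x v) =
    (k * Re (hform c (?A u) (?A v)) - \<rho>\<^sup>2 * cmet P x (\<xi> P x) u * cmet P x (\<xi> P x) v) / (c * k\<^sup>2)"
    unfolding rep_immersion[OF x] drep_immersion[OF x]
      M4_metric_affine_push[OF i x'(2) lift_positive[OF x'(1)] c_nonzero]
      lift_norm[OF P x'(1)] lift_contact[OF P x'(1)] Zv
    by (simp add: power2_eq_square mult_ac)
  also have "\<dots> = (Re (hform c (?A u) (?A v)) / k
        - \<rho>\<^sup>2 * cmet P x (\<xi> P x) u * cmet P x (\<xi> P x) v / k\<^sup>2) / c"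
    using k_pos c_nonzero by (simp add: field_simps power2_eq_square)
  finally show ?thesis
    unfolding lift_metric[OF P x'(1)] using c_nonzero by simp
qed

lemma lift_derivative_linear: "x \<in> cdom P \<Longrightarrow> linear (lift_derivative F P x)"
  by (rule has_derivative_linear[OF lift_has_derivative])

lemma drep_immersion_inj:
  assumes x: "x \<in> rep_dom immersion P (M4_chart c i)"
  shows "inj (drep immersion P (M4_chart c i) x)"
proof -
  have x': "x \<in> cdom P" "F (cpar P x) $ i \<noteq> 0" using x by (auto simp: rep_dom_immersion)
  have lin: "linear (drep immersion P (M4_chart c i) x)"
    using linear_compose[OF lift_derivative_linear[OF x'(1)]
        bounded_linear.linear[OF bounded_linear_affine_push[of c i "F (cpar P x)"]]]
    by (simp add: drep_immersion[OF x, abs_def] comp_def)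
  have "u = 0" if "drep immersion P (M4_chart c i) x u = 0" for u
  proof (rule metric_definite[OF P x'(1)])
    show "cmet P x u u = 0"
      unfolding immersion_isometric[OF x, symmetric] that by (simp add: M4_chart_def hermitian_def)
  qed
  then show ?thesis using linear_injective_0[OF lin] by blast
qed

lemma pole_orthogonal:
  assumes "x \<in> cdom P"
  shows "hform c (lift_derivative F P x u) pole = 0"
proof -
  have "bounded_linear (hform c pole)"
    by (simp add: linear_iff scaleR_conv_of_real[where 'a=complex] flip: linear_conv_bounded_linear)
  from bounded_linear.has_derivative[OF this lift_has_derivative[OF assms]]
  have "((\<lambda>x. of_real m) has_derivative (\<lambda>u. hform c pole (lift_derivative F P x u))) (at x)"
    by (rule has_derivative_transform_within_open[OF _ open_domain assms])
      (simp add: lift_pole[OF P])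
  with has_derivative_const have "(\<lambda>u. hform c pole (lift_derivative F P x u)) = (\<lambda>u. 0)"
    by (rule has_derivative_unique[rotated])
  then have "hform c pole (lift_derivative F P x u) = 0" by meson
  then show ?thesis by (metis complex_cnj_zero hform_simps(10))
qed

lemma normal_unit:
  assumes x: "x \<in> rep_dom immersion P (M4_chart c i)"
  shows "cmet (M4_chart c i) (rep immersion P (M4_chart c i) x)
    (normal (M4_chart c i) (cpar P x)) (normal (M4_chart c i) (cpar P x)) = 1"
proof -
  have x': "x \<in> cdom P" "F (cpar P x) $ i \<noteq> 0" using x by (auto simp: rep_dom_immersion)
  have "hform c (F (cpar P x)) pole = of_real m"
    using lift_pole[OF P x'(1)] by (metis complex_cnj_complex_of_real hform_simps(10))
  then have "cmet (M4_chart c i) (rep immersion P (M4_chart c i) x)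
      (normal (M4_chart c i) (cpar P x)) (normal (M4_chart c i) (cpar P x)) =
      \<nu>\<^sup>2 * (k * Re (hform c pole pole) - m\<^sup>2) / (c * k\<^sup>2)"
    unfolding rep_immersion[OF x] normal_def chart_index
      M4_metric_affine_push[OF i x'(2) lift_positive[OF x'(1)] c_nonzero] lift_norm[OF P x'(1)]
    by (simp add: lift_pole[OF P x'(1)] power2_eq_square algebra_simps)
  then show ?thesis unfolding normal_scale using c_nonzero k_pos by simp
qed

lemma normal_orthogonal:
  assumes x: "x \<in> rep_dom immersion P (M4_chart c i)"
  shows "cmet (M4_chart c i) (rep immersion P (M4_chart c i) x)
    (drep immersion P (M4_chart c i) x u) (normal (M4_chart c i) (cpar P x)) = 0"
proof -
  have x': "x \<in> cdom P" "F (cpar P x) $ i \<noteq> 0" using x by (auto simp: rep_dom_immersion)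
  have "hform c (F (cpar P x)) pole = of_real m"
    using lift_pole[OF P x'(1)] by (metis complex_cnj_complex_of_real hform_simps(10))
  then show ?thesis
    unfolding rep_immersion[OF x] drep_immersion[OF x] normal_def chart_index
      M4_metric_affine_push[OF i x'(2) lift_positive[OF x'(1)] c_nonzero] lift_norm[OF P x'(1)]
    by (simp add: lift_contact[OF P x'(1)] pole_orthogonal[OF x'(1)])
qed

text \<open>The normal field is represented by a constant vector, so that
  \<open>affine_push_has_derivative\<close> and \<open>christoffel_affine_push\<close> leave one term of the connection.\<close>

lemma covariant_derivative_normal:
  assumes x: "x \<in> rep_dom immersion P (M4_chart c i)"
  shows "- covariant_derivative immersion normal P (M4_chart c i) x u =
    affine_push c i (F (cpar P x)) ((\<nu> * m / k) *\<^sub>R lift_derivative F P x u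
      + (\<i> * of_real (\<nu> * \<rho> / k * cmet P x (\<xi> P x) u)) *s pole)"
proof -
  have x': "x \<in> cdom P" "F (cpar P x) $ i \<noteq> 0" using x by (auto simp: rep_dom_immersion)
  let ?Z = "F (cpar P x)" and ?A = "lift_derivative F P x u" and ?N = "\<nu> *\<^sub>R pole"
  have "((\<lambda>x. normal (M4_chart c i) (cpar P x)) has_derivative
      (\<lambda>u. - ((lift_derivative F P x u $ i / ?Z$i) *s affine_push c i ?Z ?N)
        - (?N$i / ?Z$i) *s affine_push c i ?Z (lift_derivative F P x u))) (at x)"
    unfolding normal_def chart_index
    by (rule has_derivative_compose[OF lift_has_derivative[OF x'(1)]
          affine_push_has_derivative[OF x'(2)]])
  then have "frechet_derivative (\<lambda>x. normal (M4_chart c i) (cpar P x)) (at x) u =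
      - ((?A$i / ?Z$i) *s affine_push c i ?Z ?N) - (?N$i / ?Z$i) *s affine_push c i ?Z ?A"
    by (simp add: frechet_derivative_at[symmetric])
  moreover have cancel: "- (- a - b + (a + b - w)) = w" for a b w :: "complex^2" by simp
  ultimately have "- covariant_derivative immersion normal P (M4_chart c i) x u =
      affine_push c i ?Z ((hform c ?A ?Z / hform c ?Z ?Z) *s ?N + (hform c ?N ?Z / hform c ?Z ?Z) *s ?A)"
    unfolding covariant_derivative_def rep_immersion[OF x] drep_immersion[OF x]
      normal_def chart_index christoffel_affine_push[OF i x'(2) lift_positive[OF x'(1)]]
    by (simp only: cancel)
  moreover have "(hform c ?A ?Z / hform c ?Z ?Z) *s ?N + (hform c ?N ?Z / hform c ?Z ?Z) *s ?A =
      (\<nu> * m / k) *\<^sub>R ?A + (\<i> * of_real (\<nu> * \<rho> / k * cmet P x (\<xi> P x) u)) *s pole"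
    by (simp add: lift_contact[OF P x'(1)] lift_norm[OF P x'(1)] lift_pole[OF P x'(1)] vec_eq_iff
        scaleR_conv_of_real[where 'a=complex] mult_ac)
  ultimately show ?thesis by (simp only:)
qed

text \<open>The multiple of \<open>pole\<close> in \<open>covariant_derivative_normal\<close> is vertical: modulo the line of \<open>F\<close>, which
  represents no tangent vector, \<open>\<i> pole\<close> is \<open>1/\<delta>\<close> times the derivative of \<open>F\<close> along \<open>\<xi>\<close>.\<close>

lemma weingarten_immersion:
  assumes x: "x \<in> rep_dom immersion P (M4_chart c i)"
  shows "weingarten immersion normal P (M4_chart c i) x u =
    (\<nu> * m / k) *\<^sub>R u + (\<nu> * \<rho> / (k * \<delta>) * cmet P x (\<xi> P x) u) *\<^sub>R \<xi> P x"
    (is "_ = ?v")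
proof -
  have x': "x \<in> cdom P" "F (cpar P x) $ i \<noteq> 0" using x by (auto simp: rep_dom_immersion)
  let ?b = "\<nu> * \<rho> / (k * \<delta>) * cmet P x (\<xi> P x) u"
  interpret D: linear "lift_derivative F P x" by (rule lift_derivative_linear[OF x'(1)])
  have "lift_derivative F P x ?v = (\<nu> * m / k) *\<^sub>R lift_derivative F P x u
      + ?b *\<^sub>R (\<i> *s (\<delta> *\<^sub>R pole + \<delta>' *\<^sub>R F (cpar P x)))"
    by (simp add: D.add D.scaleR lift_vertical[OF P x'(1)])
  also have "\<dots> = ((\<nu> * m / k) *\<^sub>R lift_derivative F P x u
      + (\<i> * of_real (?b * \<delta>)) *s pole) + (\<i> * of_real (?b * \<delta>')) *s F (cpar P x)"
    by (simp add: vec_eq_iff scaleR_conv_of_real[where 'a=complex] algebra_simps)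
  also have "?b * \<delta> = \<nu> * \<rho> / k * cmet P x (\<xi> P x) u"
    using \<delta>_nonzero by simp
  finally have "drep immersion P (M4_chart c i) x ?v =
      - covariant_derivative immersion normal P (M4_chart c i) x u"
    unfolding covariant_derivative_normal[OF x] drep_immersion[OF x]
    by (simp only: affine_push_simps(1,2) affine_push_self[OF x'(2)] vector_smult_rzero add_0_right)
  then show ?thesis
    unfolding weingarten_def using drep_immersion_inj[OF x, THEN injD] by (intro the_equality) metis+
qed

text \<open>The endomorphism \<open>\<eta> \<otimes> \<xi>\<close> has trace \<open>\<eta>(\<xi>) = 1\<close>. Linearity of \<open>\<eta>\<close> is read off from
  \<open>lift_contact\<close>, with \<open>\<rho> \<noteq> 0\<close>.\<close>

lemma mean_curvature_immersion:
  assumes x: "x \<in> rep_dom immersion P (M4_chart c i)"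
  shows "mean_curvature immersion normal P (M4_chart c i) x =
    \<nu> * m / k + \<nu> * \<rho> / (k * \<delta>) / DIM('d)"
proof -
  have x': "x \<in> cdom P" using x by (auto simp: rep_dom_immersion)
  let ?\<eta> = "cmet P x (\<xi> P x)"
  interpret D: linear "lift_derivative F P x" by (rule lift_derivative_linear[OF x'])
  have \<eta>: "?\<eta> u = Im (hform c (lift_derivative F P x u) (F (cpar P x))) / \<rho>" for u
    using \<rho>_nonzero by (simp add: lift_contact[OF P x'])
  have "linear ?\<eta>"
    by (rule linearI) (simp_all add: \<eta> D.add D.scaleR add_divide_distrib)
  then interpret \<eta>: linear ?\<eta> .
  have "(\<Sum>b\<in>Basis. ?\<eta> b * (\<xi> P x \<bullet> b)) = ?\<eta> (\<Sum>b\<in>Basis. (\<xi> P x \<bullet> b) *\<^sub>R b)"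
    by (simp add: \<eta>.sum \<eta>.scaleR mult.commute)
  also have "\<dots> = 1" by (simp add: euclidean_representation vertical_unit[OF P x'])
  finally have trace: "(\<Sum>b\<in>Basis. ?\<eta> b * (\<xi> P x \<bullet> b)) = 1" .
  have "(\<Sum>b\<in>Basis. weingarten immersion normal P (M4_chart c i) x b \<bullet> b) =
      (\<Sum>b\<in>(Basis :: 'd set). \<nu> * m / k + \<nu> * \<rho> / (k * \<delta>) * (?\<eta> b * (\<xi> P x \<bullet> b)))"
    by (rule sum.cong) (simp_all add: weingarten_immersion[OF x] inner_add_left)
  also have "\<dots> = DIM('d) * (\<nu> * m / k) + \<nu> * \<rho> / (k * \<delta>)"
    unfolding sum.distrib sum_distrib_left[symmetric] trace by simp
  finally show ?thesis
    unfolding mean_curvature_def by (simp add: add_divide_distrib)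
qed

end

theorem eta_umbilic_immersion:
  "isometric_immersion E (M4_space c) immersion"
  "unit_normal_field E (M4_space c) immersion normal"
  "constant_mean_curvature E (M4_space c) immersion normal"
  "eta_umbilic \<xi> E (M4_space c) immersion normal"
proof -
  have image: "immersion p \<in> points (M4_space c)" if p: "p \<in> points E" for p
  proof -
    from p obtain P x where "P \<in> E" "x \<in> cdom P" "p = cpar P x"
      by (auto simp: points_def cimage_def)
    then show ?thesis
      unfolding immersion_def
      by (intro complex_line_in_M4_space[OF c_nonzero]) (simp add: lift_norm k_pos)
  qed
  have "C_infinity_on (rep immersion P Q) (rep_dom immersion P Q)" if "P \<in> E" "Q \<in> M4_space c" for P Q
    by (rule M4_space_cases[OF c_nonzero that(2)]) (simp add: rep_immersion_smooth[OF that(1)])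
  with image have "smooth_map E (M4_space c) immersion"
    unfolding smooth_map_def by blast
  moreover have "inj (drep immersion P Q x) \<and> (\<forall>u v. cmet Q (rep immersion P Q x)
        (drep immersion P Q x u) (drep immersion P Q x v) = cmet P x u v)"
    if "P \<in> E" "Q \<in> M4_space c" "x \<in> rep_dom immersion P Q" for P Q x
    by (rule M4_space_cases[OF c_nonzero that(2)])
      (use that(3) in \<open>simp add: immersion_isometric[OF that(1)] drep_immersion_inj[OF that(1)]\<close>)
  ultimately show "isometric_immersion E (M4_space c) immersion"
    unfolding isometric_immersion_def by blast
  have "normal Q' p = drep id Q Q' (coord Q (immersion p)) (normal Q p)"
    if p: "p \<in> points E" and Q: "Q \<in> M4_space c" "Q' \<in> M4_space c"
      and "immersion p \<in> cimage Q \<inter> cimage Q'" for p Q Q'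
  proof -
    obtain i j where ij: "Q = M4_chart c i" "c \<le> 0 \<longrightarrow> i = 1" "Q' = M4_chart c j" "c \<le> 0 \<longrightarrow> j = 1"
      using Q M4_space_cases[OF c_nonzero] by metis
    from p obtain P x where "P \<in> E" "x \<in> cdom P" "p = cpar P x"
      by (auto simp: points_def cimage_def)
    then have pos: "Re (hform c (F p) (F p)) > 0" using lift_positive by blast
    have nz: "F p $ i \<noteq> 0" "F p $ j \<noteq> 0"
      using that(4) by (auto simp: ij immersion_def dest: complex_line_in_chartD)
    show ?thesis
      using affine_push_change_of_charts[OF c_nonzero ij(2,4) nz pos]
        complex_line_in_chart(2)[OF c_nonzero ij(2) nz(1) pos]
      by (simp only: ij(1,3) immersion_def normal_def chart_index)
  qed
  moreover have "C_infinity_on (\<lambda>x. normal Q (cpar P x)) (rep_dom immersion P Q)"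
    if "P \<in> E" "Q \<in> M4_space c" for P Q
    by (rule M4_space_cases[OF c_nonzero that(2)]) (simp add: normal_smooth[OF that(1)])
  ultimately have "smooth_field_along E (M4_space c) immersion normal"
    unfolding smooth_field_along_def by blast
  moreover have "cmet Q (rep immersion P Q x) (normal Q (cpar P x)) (normal Q (cpar P x)) = 1 \<and>
      (\<forall>u. cmet Q (rep immersion P Q x) (drep immersion P Q x u) (normal Q (cpar P x)) = 0)"
    if "P \<in> E" "Q \<in> M4_space c" "x \<in> rep_dom immersion P Q" for P Q x
    by (rule M4_space_cases[OF c_nonzero that(2)])
      (use that(3) in \<open>simp add: normal_unit[OF that(1)] normal_orthogonal[OF that(1)]\<close>)
  ultimately show "unit_normal_field E (M4_space c) immersion normal"
    unfolding unit_normal_field_def by blast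
  have "mean_curvature immersion normal P Q x = \<nu> * m / k + \<nu> * \<rho> / (k * \<delta>) / DIM('d)"
    if "P \<in> E" "Q \<in> M4_space c" "x \<in> rep_dom immersion P Q" for P Q x
    by (rule M4_space_cases[OF c_nonzero that(2)])
      (use that(3) in \<open>simp add: mean_curvature_immersion[OF that(1)]\<close>)
  then show "constant_mean_curvature E (M4_space c) immersion normal"
    unfolding constant_mean_curvature_def by blast
  have "weingarten immersion normal P Q x u =
      (\<nu> * m / k) *\<^sub>R u + (\<nu> * \<rho> / (k * \<delta>) * cmet P x (\<xi> P x) u) *\<^sub>R \<xi> P x"
    if "P \<in> E" "Q \<in> M4_space c" "x \<in> rep_dom immersion P Q" for P Q x u
    by (rule M4_space_cases[OF c_nonzero that(2)])
      (use that(3) in \<open>simp add: weingarten_immersion[OF that(1)]\<close>)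
  then show "eta_umbilic \<xi> E (M4_space c) immersion normal"
    unfolding eta_umbilic_def
    by (intro exI[of _ "\<lambda>_. \<nu> * m / k"] exI[of _ "\<lambda>_. \<nu> * \<rho> / (k * \<delta>)"]) blast
qed

end

section \<open>Stereographic charts of the Berger sphere\<close>

text \<open>The stereographic projections start from the points \<open>\<plusminus> north\<close> and land in the hyperplane orthogonal to
  \<open>north\<close>, which \<open>equator\<close> identifies with \<open>\<real>\<^sup>3\<close>.\<close>

definition equator :: "real^3 \<Rightarrow> complex^2" where
  "equator x = vector [Complex (x$1) (x$2), complex_of_real (x$3)]"

definition north :: "complex^2" where
  "north = vector [0, \<i>]"

lemma inner_complex_2: "(u :: complex^2) \<bullet> v
    = Re (u$1) * Re (v$1) + Im (u$1) * Im (v$1) + (Re (u$2) * Re (v$2) + Im (u$2) * Im (v$2))"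
  by (simp add: inner_vec_def sum_2 inner_complex_def)

lemma equator_inner [simp]:
  "equator x \<bullet> equator y = x \<bullet> y" "equator x \<bullet> north = 0" "north \<bullet> equator x = 0" "north \<bullet> north = 1"
  by (simp_all add: inner_complex_2 equator_def north_def inner_vec_def[of x y] sum_3)

lemma bounded_linear_equator: "bounded_linear equator"
  by (simp add: linear_iff equator_def vec_eq_iff forall_2 complex_eq_iff
      flip: linear_conv_bounded_linear)

lemmas equator_linear =
  linear_add[OF bounded_linear.linear[OF bounded_linear_equator]]
  linear_scale[OF bounded_linear.linear[OF bounded_linear_equator]]

lemma equator_north_decomp: "\<exists>y t. v = equator y + t *\<^sub>R north"
  by (rule exI[of _ "vector [Re (v$1), Im (v$1), Re (v$2)]"], rule exI[of _ "Im (v$2)"])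
    (simp add: equator_def north_def vec_eq_iff forall_2 complex_eq_iff)

lemma stereographic_eq:
  "stereographic s x = inverse (1 + x \<bullet> x) *\<^sub>R (2 *\<^sub>R equator x + (s * (x \<bullet> x - 1)) *\<^sub>R north)"
  by (simp add: stereographic_def equator_def north_def vec_eq_iff forall_2 complex_eq_iff
      power2_norm_eq_inner divide_inverse)

lemma one_plus_inner_pos: "1 + x \<bullet> x > (0 :: real)"
  using inner_ge_zero[of x] by linarith

text \<open>The derivative of \<open>stereographic s\<close> at \<open>x\<close>.\<close>

definition stereographic_push :: "real \<Rightarrow> real^3 \<Rightarrow> real^3 \<Rightarrow> complex^2" where
  "stereographic_push s x u = (2 / (1 + x \<bullet> x)) *\<^sub>R equator u
     - (4 * (x \<bullet> u) / (1 + x \<bullet> x)\<^sup>2) *\<^sub>R equator x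
     + (4 * s * (x \<bullet> u) / (1 + x \<bullet> x)\<^sup>2) *\<^sub>R north"

lemma stereographic_has_derivative:
  "(stereographic s has_derivative stereographic_push s x) (at x)"
proof -
  define n where "n = 1 + x \<bullet> x"
  have "n > 0" unfolding n_def by (rule one_plus_inner_pos)
  have sq: "((\<lambda>x. x \<bullet> x) has_derivative (\<lambda>u. 2 * (x \<bullet> u))) (at x)"
    using bounded_bilinear.FDERIV[OF bounded_bilinear_inner has_derivative_ident has_derivative_ident,
        of x UNIV]
    by (simp add: inner_commute)
  have inv: "((\<lambda>x. inverse (1 + x \<bullet> x)) has_derivative (\<lambda>u. - (2 * (x \<bullet> u) / n\<^sup>2))) (at x)"
    using Deriv.has_derivative_inverse[OF _ has_derivative_add[OF has_derivative_const sq], of 1]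
      \<open>n > 0\<close>
    by (simp add: n_def power2_eq_square divide_inverse mult_ac)
  have pole: "((\<lambda>x. s * (x \<bullet> x - 1)) has_derivative (\<lambda>u. s * (2 * (x \<bullet> u)))) (at x)"
    using has_derivative_mult_right[OF has_derivative_diff[OF sq has_derivative_const]] by simp
  have "(stereographic s has_derivative (\<lambda>u.
      inverse n *\<^sub>R (2 *\<^sub>R equator u + (s * (2 * (x \<bullet> u))) *\<^sub>R north)
      + (- (2 * (x \<bullet> u) / n\<^sup>2)) *\<^sub>R (2 *\<^sub>R equator x + (s * (x \<bullet> x - 1)) *\<^sub>R north))) (at x)"
    unfolding stereographic_eq[abs_def] n_def
    by (intro bounded_bilinear.FDERIV[OF bounded_bilinear_scaleR] inv[unfolded n_def]
        has_derivative_add bounded_linear.has_derivative[OF bounded_linear_scaleR_right]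
        bounded_linear.has_derivative[OF bounded_linear_scaleR_left] pole
        bounded_linear_imp_has_derivative[OF bounded_linear_equator])
  moreover have "inverse n *\<^sub>R (2 *\<^sub>R equator u + (s * (2 * (x \<bullet> u))) *\<^sub>R north)
      + (- (2 * (x \<bullet> u) / n\<^sup>2)) *\<^sub>R (2 *\<^sub>R equator x + (s * (x \<bullet> x - 1)) *\<^sub>R north)
      = stereographic_push s x u" for u
  proof -
    have "inverse n * (s * (2 * (x \<bullet> u))) - (2 * (x \<bullet> u) / n\<^sup>2) * (s * (n - 2))
        = 4 * s * (x \<bullet> u) / n\<^sup>2"
      using \<open>n > 0\<close> by (simp add: field_simps power2_eq_square)
    moreover have "inverse n *\<^sub>R (2 *\<^sub>R equator u + (s * (2 * (x \<bullet> u))) *\<^sub>R north)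
      + (- (2 * (x \<bullet> u) / n\<^sup>2)) *\<^sub>R (2 *\<^sub>R equator x + (s * (n - 2)) *\<^sub>R north)
      = (2 / n) *\<^sub>R equator u - (4 * (x \<bullet> u) / n\<^sup>2) *\<^sub>R equator x
        + (inverse n * (s * (2 * (x \<bullet> u))) - (2 * (x \<bullet> u) / n\<^sup>2) * (s * (n - 2))) *\<^sub>R north"
      by (simp add: algebra_simps divide_inverse)
    ultimately show ?thesis
      unfolding stereographic_push_def by (simp add: n_def)
  qed
  ultimately show ?thesis by (simp only:)
qed

lemma frechet_derivative_stereographic:
  "frechet_derivative (stereographic s) (at x) = stereographic_push s x"
  by (rule frechet_derivative_at[OF stereographic_has_derivative, symmetric])

lemma C_k_on_stereographic: "C_k_on k (stereographic s) UNIV"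
proof -
  note sq = C_k_on_bilinear[OF open_UNIV bounded_bilinear_inner C_k_on_ident[OF open_UNIV]
      C_k_on_ident[OF open_UNIV]]
  have "C_k_on k (\<lambda>x :: real^3. x \<bullet> x + (- 1)) UNIV" for k
    by (intro C_k_on_add sq C_k_on_const open_UNIV)
  then have sq1: "C_k_on k (\<lambda>x :: real^3. x \<bullet> x - 1) UNIV" for k by simp
  show ?thesis
    unfolding stereographic_eq[abs_def]
    by (intro C_k_on_bilinear[OF open_UNIV bounded_bilinear_scaleR] C_k_on_add C_k_on_inverse
        C_k_on_mult sq sq1 C_k_on_const open_UNIV C_k_on_linear[OF open_UNIV bounded_linear_equator])
      (simp add: less_imp_neq[OF one_plus_inner_pos, symmetric])
qed

context
  fixes s :: real
  assumes s: "s\<^sup>2 = 1"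
begin

lemma stereographic_unit: "stereographic s x \<bullet> stereographic s x = 1"
proof -
  define n where "n = x \<bullet> x"
  have n: "1 + n > 0" unfolding n_def by (rule one_plus_inner_pos)
  have "stereographic s x \<bullet> stereographic s x = (inverse (1 + n))\<^sup>2 * (4 * n + s\<^sup>2 * (n - 1)\<^sup>2)"
    unfolding stereographic_eq n_def[symmetric]
    by (simp add: inner_add_left inner_add_right n_def[symmetric] power2_eq_square algebra_simps)
  also have "4 * n + s\<^sup>2 * (n - 1)\<^sup>2 = (1 + n)\<^sup>2"
    unfolding s by (simp add: power2_eq_square algebra_simps)
  also have "(inverse (1 + n))\<^sup>2 * (1 + n)\<^sup>2 = 1" using n by (simp flip: power_mult_distrib)
  finally show ?thesis .
qed

lemma stereographic_push_tangent: "stereographic_push s x u \<bullet> stereographic s x = 0"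
proof -
  define n t where "n = x \<bullet> x" and "t = x \<bullet> u"
  have n: "1 + n > 0" unfolding n_def by (rule one_plus_inner_pos)
  define a b where "a = 2 / (1 + n)" and "b = 4 * t / (1 + n)\<^sup>2"
  have push: "stereographic_push s x u = a *\<^sub>R equator u - b *\<^sub>R equator x + (s * b) *\<^sub>R north"
    by (simp add: stereographic_push_def a_def b_def n_def t_def mult_ac)
  have "stereographic_push s x u \<bullet> stereographic s x
      = inverse (1 + n) * (2 * a * t - 2 * b * n + s\<^sup>2 * b * (n - 1))"
    unfolding push stereographic_eq n_def[symmetric]
    by (simp add: inner_add_left inner_add_right inner_diff_left n_def[symmetric]
        t_def inner_commute[of u x] power2_eq_square algebra_simps)
  also have "2 * a * t = b * (1 + n)"
    using n by (simp add: a_def b_def power2_eq_square)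
  also have "inverse (1 + n) * (b * (1 + n) - 2 * b * n + s\<^sup>2 * b * (n - 1)) = 0"
    unfolding s by (simp add: algebra_simps)
  finally show ?thesis .
qed

text \<open>The component along \<open>north\<close> is \<open>4 s (x \<bullet> u) / (1 + \<bar>x\<bar>\<^sup>2)\<^sup>2\<close>, so it detects \<open>x \<bullet> u\<close>;
  once this vanishes, the other components are those of \<open>u\<close> up to a factor.\<close>

lemma stereographic_push_eq_0:
  assumes "stereographic_push s x u = 0"
  shows "u = 0"
proof -
  define n where "n = 1 + x \<bullet> x"
  have n: "n > 0" unfolding n_def by (rule one_plus_inner_pos)
  have "s \<noteq> 0" using s by auto
  have "stereographic_push s x u \<bullet> north = 4 * s * (x \<bullet> u) / n\<^sup>2"
    by (simp add: stereographic_push_def inner_add_left inner_diff_left n_def)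
  then have xu: "x \<bullet> u = 0" using assms n \<open>s \<noteq> 0\<close> by simp
  have "stereographic_push s x u \<bullet> equator u = 2 / n * (u \<bullet> u)"
    by (simp add: stereographic_push_def inner_add_left inner_diff_left n_def xu)
  then show ?thesis using assms n by simp
qed

lemma stereographic_push_surj:
  assumes "v \<bullet> stereographic s x = 0"
  shows "\<exists>u. stereographic_push s x u = v"
proof -
  define n where "n = x \<bullet> x"
  have n: "1 + n > 0" unfolding n_def by (rule one_plus_inner_pos)
  obtain y t where v: "v = equator y + t *\<^sub>R north" using equator_north_decomp by blast
  have "2 * (x \<bullet> y) + s * t * (n - 1) = 0"
    using assms n unfolding v stereographic_eq n_def[symmetric]
    by (simp add: inner_add_left inner_add_right inner_commute[of y x] mult_ac)
  then have xy: "x \<bullet> y = s * t * (1 - n) / 2" by (simp add: algebra_simps)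
  \<comment> \<open>The derivative of the stereographic projection \<open>equator y + t north \<mapsto> y / (1 - s t)\<close>.\<close>
  define u where "u = ((1 + n) / 2) *\<^sub>R (y + (s * t) *\<^sub>R x)"
  have xu: "x \<bullet> u = (1 + n)\<^sup>2 / 4 * (s * t)"
    by (simp add: u_def inner_add_right xy n_def[symmetric] power2_eq_square field_simps)
  have "4 * s * (x \<bullet> u) / (1 + n)\<^sup>2 = s\<^sup>2 * t"
    using n by (simp add: xu power2_eq_square)
  then have 1: "4 * s * (x \<bullet> u) / (1 + n)\<^sup>2 = t" by (simp add: s)
  have 2: "4 * (x \<bullet> u) / (1 + n)\<^sup>2 = s * t"
    using n by (simp add: xu)
  have 3: "(2 / (1 + n)) *\<^sub>R equator u = equator y + (s * t) *\<^sub>R equator x"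
  proof -
    have "2 / (1 + n) * ((1 + n) / 2) = 1" using n by simp
    then show ?thesis by (simp only: u_def equator_linear scaleR_scaleR scaleR_one)
  qed
  have "stereographic_push s x u = v"
    unfolding stereographic_push_def n_def[symmetric] 1 2 3 v by simp
  then show ?thesis ..
qed

end

lemma ii_mult_inner:
  fixes p :: "complex^2"
  shows
  "(\<i> *s p) \<bullet> p = 0" "(\<i> *s p) \<bullet> (\<i> *s p) = p \<bullet> p"
  by (simp_all add: inner_complex_2)

lemma Im_hermitian: "Im (hermitian u v) = u \<bullet> (\<i> *s v)"
  by (simp add: hermitian_def sum_2 inner_complex_2)

lemma E_vertical_push:
  assumes "\<kappa> > 0" and s: "s\<^sup>2 = 1"
  shows "stereographic_push s x (E_vertical \<kappa> \<tau> (E_chart_pos \<kappa> \<tau> s) x) =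
    (\<kappa> / (4 * \<tau>)) *\<^sub>R (\<i> *s stereographic s x)"
proof -
  have "((\<kappa> / (4 * \<tau>)) *\<^sub>R (\<i> *s stereographic s x)) \<bullet> stereographic s x = 0"
    by (simp add: ii_mult_inner)
  then obtain u where u: "stereographic_push s x u = (\<kappa> / (4 * \<tau>)) *\<^sub>R (\<i> *s stereographic s x)"
    using stereographic_push_surj[OF s] by blast
  interpret D: linear "stereographic_push s x"
    by (rule has_derivative_linear[OF stereographic_has_derivative])
  have uniq: "u' = u" if "stereographic_push s x u' = (\<kappa> / (4 * \<tau>)) *\<^sub>R (\<i> *s stereographic s x)" for u'
  proof -
    have "stereographic_push s x (u' - u) = 0" by (simp only: D.diff that u diff_self)
    then have "u' - u = 0" by (rule stereographic_push_eq_0[OF s])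
    then show ?thesis by simp
  qed
  have "E_vertical \<kappa> \<tau> (E_chart_pos \<kappa> \<tau> s) x
      = (THE u. stereographic_push s x u = (\<kappa> / (4 * \<tau>)) *\<^sub>R (\<i> *s stereographic s x))"
    using assms(1) unfolding E_vertical_def E_chart_pos_def chart.simps frechet_derivative_stereographic
    by (simp only: not_le[symmetric] if_False)
  also have "\<dots> = u"
    using u uniq by (rule the_equality)
  finally show ?thesis using u by (simp only:)
qed

text \<open>The fiber component satisfies \<open>\<langle>v, \<i> p\<rangle>\<^sup>2 \<le> |v|\<^sup>2\<close>, and its total weight \<open>4 \<tau>\<^sup>2 / \<kappa>\<close> is positive.\<close>

lemma berger_metric_definite:
  assumes "\<kappa> > 0" and "\<tau> \<noteq> 0" and "p \<bullet> p = 1" and "berger_metric \<kappa> \<tau> p v v = 0"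
  shows "v = 0"
proof -
  define y where "y = v \<bullet> (\<i> *s p)"
  have "y\<^sup>2 \<le> (v \<bullet> v) * ((\<i> *s p) \<bullet> (\<i> *s p))"
    unfolding y_def by (rule Cauchy_Schwarz_ineq)
  then have le: "y\<^sup>2 \<le> v \<bullet> v" by (simp add: ii_mult_inner assms(3))
  have eq: "v \<bullet> v + (4 * \<tau>\<^sup>2 / \<kappa> - 1) * y\<^sup>2 = 0"
    using assms(1,4) by (simp add: berger_metric_def y_def[symmetric] power2_eq_square mult.assoc)
  then have "4 * \<tau>\<^sup>2 / \<kappa> * y\<^sup>2 \<le> 0" using le by (simp add: algebra_simps)
  moreover have "4 * \<tau>\<^sup>2 / \<kappa> > 0" using assms(1,2) by simp
  ultimately have "y\<^sup>2 \<le> 0" by (metis mult_pos_pos not_less)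
  then show ?thesis using eq by simp
qed

section \<open>Positive base curvature: geodesic spheres\<close>

text \<open>In the first affine chart this is a dilation of the unit sphere, and the pole is the center
  \<open>(1, 0, 0)\<close>.\<close>

definition sphere_lift :: "real \<Rightarrow> complex^2 \<Rightarrow> complex^3" where
  "sphere_lift r p = vector [1, of_real r * p$1, of_real r * p$2]"

lemma sphere_lift_has_derivative:
  "((\<lambda>x. sphere_lift r (stereographic s x)) has_derivative
    (\<lambda>u. vector [0, of_real r * stereographic_push s x u $ 1, of_real r * stereographic_push s x u $ 2])) (at x)"
  unfolding sphere_lift_def
  by (intro has_derivative_vector_3 has_derivative_const has_derivative_mult_right
      bounded_linear.has_derivative[OF bounded_linear_vec_nth] stereographic_has_derivative)

text \<open>The sphere \<open>|w| = R\<close> of the first affine chart carries the metric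
  \<open>R\<^sup>2/D (\<langle>X, Y\<rangle> - c R\<^sup>2/D \<langle>X, V\<rangle> \<langle>Y, V\<rangle>)\<close>, where \<open>D = 1 + c R\<^sup>2\<close>. Comparison with the Berger metric gives
  \<open>R = 1 / |\<tau>|\<close> and \<open>D = \<kappa> / (4 \<tau>\<^sup>2)\<close>; the radius \<open>r\<close> of the lift is \<open>R\<close> times \<open>sqrt |c|\<close>. A fiber
  acts by \<open>F \<mapsto> pole + exp(\<i> t) (F - pole)\<close>, whence the opposite values of \<open>\<delta>\<close> and \<open>\<delta>'\<close>.\<close>

lemma pole_lift_sphere:
  fixes \<kappa> \<tau> :: real
  defines "c \<equiv> \<kappa> / 4 - \<tau>\<^sup>2"
  assumes \<kappa>: "\<kappa> > 0" and \<tau>: "\<tau> \<noteq> 0" and c: "c \<noteq> 0"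
  shows "pole_lift c (\<kappa> / (4 * \<tau>\<^sup>2)) 1 (c * \<kappa> / (4 * \<tau>^3)) (- \<kappa> / (4 * \<tau>)) (\<kappa> / (4 * \<tau>))
    (\<kappa> / (4 * \<tau>)) (E_space \<kappa> \<tau>) (sphere_lift (sqrt \<bar>c\<bar> / \<bar>\<tau>\<bar>)) (vector [1, 0, 0]) (E_vertical \<kappa> \<tau>)"
proof -
  define r where "r = sqrt \<bar>c\<bar> / \<bar>\<tau>\<bar>"
  have r2: "sgn c * r\<^sup>2 = c / \<tau>\<^sup>2"
    using sgn_mult_abs[of c] by (simp add: r_def power_divide)
  then have r2': "complex_of_real (sgn c) * (of_real r * of_real r) = of_real (c / \<tau>\<^sup>2)"
    by (simp add: power2_eq_square flip: of_real_mult)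
  let ?F = "sphere_lift r"
  let ?\<xi> = "E_vertical \<kappa> \<tau>"
  have form: "hform c (vector [a, of_real r * v$1, of_real r * v$2]) (vector [b, of_real r * w$1, of_real r * w$2])
     = a * cnj b + of_real (c / \<tau>\<^sup>2) * hermitian v w" for a b v w
    unfolding r2'[symmetric] by (simp add: hform_def hermitian_def sum_2 algebra_simps)
  have lift': "lift_derivative ?F (E_chart_pos \<kappa> \<tau> s) x u =
      vector [0, of_real r * stereographic_push s x u $ 1, of_real r * stereographic_push s x u $ 2]" for s x u
    unfolding lift_derivative_def E_chart_pos_def chart.simps
    by (simp only: frechet_derivative_at[OF sphere_lift_has_derivative, symmetric])
  have met: "cmet (E_chart_pos \<kappa> \<tau> s) x u v
      = berger_metric \<kappa> \<tau> (stereographic s x) (stereographic_push s x u) (stereographic_push s x v)" for s x u v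
    by (simp add: E_chart_pos_def frechet_derivative_stereographic)
  have \<eta>: "cmet (E_chart_pos \<kappa> \<tau> s) x (?\<xi> (E_chart_pos \<kappa> \<tau> s) x) u
      = 4 * \<tau> / \<kappa> * (stereographic_push s x u \<bullet> (\<i> *s stereographic s x))" if s: "s\<^sup>2 = 1" for s x u
  proof -
    define y where "y = stereographic_push s x u \<bullet> (\<i> *s stereographic s x)"
    have "cmet (E_chart_pos \<kappa> \<tau> s) x (?\<xi> (E_chart_pos \<kappa> \<tau> s) x) u
        = 4 / \<kappa> * (\<kappa> / (4 * \<tau>) * y + (4 * \<tau>\<^sup>2 / \<kappa> - 1) * (\<kappa> / (4 * \<tau>)) * y)"
      unfolding met E_vertical_push[OF \<kappa> s] berger_metric_def
      by (simp add: ii_mult_inner stereographic_unit[OF s] y_def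
          inner_commute[of "\<i> *s stereographic s x" "stereographic_push s x u"])
    also have "\<dots> = 4 * \<tau> / \<kappa> * y" using \<kappa> \<tau> by (simp add: field_simps power2_eq_square)
    finally show ?thesis unfolding y_def .
  qed
  have E: "\<exists>s. P = E_chart_pos \<kappa> \<tau> s \<and> s\<^sup>2 = 1" if "P \<in> E_space \<kappa> \<tau>" for P
    using that \<kappa> by (auto simp: E_space_def)
  have k: "1 + c / \<tau>\<^sup>2 = \<kappa> / (4 * \<tau>\<^sup>2)" using \<tau> by (simp add: c_def field_simps)
  show ?thesis
    unfolding r_def[symmetric]
  proof (rule pole_lift.intro)
    show "c \<noteq> 0" "\<kappa> / (4 * \<tau>\<^sup>2) > 0" "c * \<kappa> / (4 * \<tau>^3) \<noteq> 0" "- \<kappa> / (4 * \<tau>) \<noteq> 0"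
      using \<kappa> \<tau> c by auto
    show "(\<kappa> / (4 * \<tau>))\<^sup>2 * (\<kappa> / (4 * \<tau>\<^sup>2) * Re (hform c (vector [1, 0, 0]) (vector [1, 0, 0])) - 1\<^sup>2)
        = c * (\<kappa> / (4 * \<tau>\<^sup>2))\<^sup>2"
    proof -
      have "\<kappa> / (4 * \<tau>\<^sup>2) - 1 = c / \<tau>\<^sup>2" using k by simp
      moreover have "(\<kappa> / (4 * \<tau>))\<^sup>2 * (c / \<tau>\<^sup>2) = c * (\<kappa> / (4 * \<tau>\<^sup>2))\<^sup>2"
        using \<tau> by (simp add: field_simps power2_eq_square)
      ultimately show ?thesis by (simp add: hform_def)
    qed
  next
    fix P assume "P \<in> E_space \<kappa> \<tau>"
    then obtain s where P: "P = E_chart_pos \<kappa> \<tau> s" and s: "s\<^sup>2 = 1" using E[OF \<open>P \<in> E_space \<kappa> \<tau>\<close>] by blast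
    have "C_k_on n (\<lambda>x. ?F (stereographic s x)) UNIV" for n
      unfolding sphere_lift_def
      by (intro C_k_on_vector_3 C_k_on_const C_k_on_mult open_UNIV
          C_k_on_bounded_linear[OF open_UNIV bounded_linear_vec_nth] C_k_on_stereographic)
    then show "C_infinity_on (\<lambda>x. ?F (cpar P x)) (cdom P)"
      by (simp add: P E_chart_pos_def C_infinity_on_def)
    fix x
    let ?p = "stereographic s x" and ?D = "stereographic_push s x"
    have par: "cpar P x = ?p" by (simp add: P E_chart_pos_def)
    have pp: "hermitian ?p ?p = 1"
      by (simp add: hermitian_self power2_norm_eq_inner stereographic_unit[OF s])
    show "hform c (?F (cpar P x)) (?F (cpar P x)) = of_real (\<kappa> / (4 * \<tau>\<^sup>2))"
      unfolding par sphere_lift_def form pp k[symmetric] by simp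
    show "hform c (vector [1, 0, 0]) (?F (cpar P x)) = of_real 1"
      by (simp add: hform_def sphere_lift_def)
    show "hform c (lift_derivative ?F P x u) (?F (cpar P x))
        = \<i> * of_real (c * \<kappa> / (4 * \<tau>^3) * cmet P x (?\<xi> P x) u)" for u
    proof -
      have "hermitian (?D u) ?p = \<i> * of_real (?D u \<bullet> (\<i> *s ?p))"
        using Re_hermitian[of "?D u" ?p] Im_hermitian[of "?D u" ?p]
        by (simp add: complex_eq_iff stereographic_push_tangent[OF s])
      moreover have "c * \<kappa> / (4 * \<tau>^3) * (4 * \<tau> / \<kappa> * t) = c / \<tau>\<^sup>2 * t" for t
        using \<kappa> \<tau> by (simp add: field_simps power2_eq_square power3_eq_cube)
      ultimately show ?thesis
        unfolding par unfolding P lift' \<eta>[OF s] sphere_lift_def form by simp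
    qed
    show "Re (hform c (lift_derivative ?F P x u) (lift_derivative ?F P x v)) / (\<kappa> / (4 * \<tau>\<^sup>2))
        - (c * \<kappa> / (4 * \<tau>^3))\<^sup>2 * cmet P x (?\<xi> P x) u * cmet P x (?\<xi> P x) v / (\<kappa> / (4 * \<tau>\<^sup>2))\<^sup>2
        = c * cmet P x u v" for u v
    proof -
      define t y z where "t = ?D u \<bullet> ?D v" and "y = ?D u \<bullet> (\<i> *s ?p)" and "z = ?D v \<bullet> (\<i> *s ?p)"
      have "Re (hform c (lift_derivative ?F P x u) (lift_derivative ?F P x v)) = c / \<tau>\<^sup>2 * t"
        unfolding P lift' form by (simp add: Re_hermitian t_def)
      moreover have "c / \<tau>\<^sup>2 * t / (\<kappa> / (4 * \<tau>\<^sup>2))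
          - (c * \<kappa> / (4 * \<tau>^3))\<^sup>2 * (4 * \<tau> / \<kappa> * y) * (4 * \<tau> / \<kappa> * z) / (\<kappa> / (4 * \<tau>\<^sup>2))\<^sup>2
          = c * (4 / \<kappa> * (t - 4 * c / \<kappa> * y * z))"
        using \<kappa> \<tau> by (simp add: field_simps power2_eq_square power3_eq_cube)
      moreover have "4 * \<tau>\<^sup>2 / \<kappa> - 1 = - (4 * c / \<kappa>)"
        using \<kappa> by (simp add: c_def field_simps)
      ultimately show ?thesis
        unfolding P \<eta>[OF s] unfolding met berger_metric_def t_def[symmetric] y_def[symmetric] z_def[symmetric]
        by simp
    qed
    show "lift_derivative ?F P x (?\<xi> P x)
        = \<i> *s ((- \<kappa> / (4 * \<tau>)) *\<^sub>R vector [1, 0, 0] + (\<kappa> / (4 * \<tau>)) *\<^sub>R ?F (cpar P x))"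
      unfolding par unfolding P lift' E_vertical_push[OF \<kappa> s]
      by (simp add: sphere_lift_def vec_eq_iff forall_3 scaleR_conv_of_real[where 'a=complex])
    show "u = 0" if "cmet P x u u = 0" for u
      using that unfolding P met
      by (rule stereographic_push_eq_0[OF s, OF
            berger_metric_definite[OF \<kappa> \<tau> stereographic_unit[OF s]]])
    show "cmet P x (?\<xi> P x) (?\<xi> P x) = 1"
      unfolding P \<eta>[OF s] E_vertical_push[OF \<kappa> s] using \<kappa> \<tau>
      by (simp add: ii_mult_inner stereographic_unit[OF s])
  qed
qed

section \<open>Nonpositive base curvature: the global chart\<close>

text \<open>The functions \<open>\<lambda>\<close> and \<open>\<eta> = dz + \<tau> \<lambda> (y dx - x dy)\<close> of the model of \<open>E_chart_nonpos\<close>.\<close>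

definition conformal_factor :: "real \<Rightarrow> real^3 \<Rightarrow> real" where
  "conformal_factor \<kappa> x = 1 / (1 + \<kappa> / 4 * ((x$1)\<^sup>2 + (x$2)\<^sup>2))"

definition contact_form :: "real \<Rightarrow> real \<Rightarrow> real^3 \<Rightarrow> real^3 \<Rightarrow> real" where
  "contact_form \<kappa> \<tau> x u = u$3 + \<tau> * conformal_factor \<kappa> x * (x$2 * u$1 - x$1 * u$2)"

lemma conformal_factor_inverse:
  "conformal_factor \<kappa> x = inverse (1 + \<kappa> / 4 * ((x$1)\<^sup>2 + (x$2)\<^sup>2))"
  by (simp only: conformal_factor_def inverse_eq_divide)

lemma E_chart_nonpos_metric:
  "cmet (E_chart_nonpos \<kappa> \<tau>) x u v = (conformal_factor \<kappa> x)\<^sup>2 * (u$1 * v$1 + u$2 * v$2)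
    + contact_form \<kappa> \<tau> x u * contact_form \<kappa> \<tau> x v"
  by (simp add: E_chart_nonpos_def Let_def contact_form_def conformal_factor_def)

lemma contact_form_axis [simp]: "contact_form \<kappa> \<tau> x (axis 3 1) = 1"
  by (simp add: contact_form_def axis_def)

lemma E_chart_nonpos_vertical:
  assumes "\<kappa> \<le> 0"
  shows "E_vertical \<kappa> \<tau> P x = axis 3 1"
    and "cmet (E_chart_nonpos \<kappa> \<tau>) x (axis 3 1) u = contact_form \<kappa> \<tau> x u"
proof -
  show "E_vertical \<kappa> \<tau> P x = axis 3 1" using assms by (simp add: E_vertical_def)
  show "cmet (E_chart_nonpos \<kappa> \<tau>) x (axis 3 1) u = contact_form \<kappa> \<tau> x u"
    unfolding E_chart_nonpos_metric contact_form_axis by (simp add: axis_def)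
qed

lemma E_chart_nonpos_definite:
  assumes "x \<in> cdom (E_chart_nonpos \<kappa> \<tau>)" and "cmet (E_chart_nonpos \<kappa> \<tau>) x u u = 0"
  shows "u = 0"
proof -
  have "1 + \<kappa> / 4 * ((x$1)\<^sup>2 + (x$2)\<^sup>2) > 0"
    using assms(1) unfolding E_chart_nonpos_def chart.simps by (rule CollectD)
  then have "conformal_factor \<kappa> x \<noteq> 0"
    unfolding conformal_factor_inverse by simp
  then have l: "(conformal_factor \<kappa> x)\<^sup>2 > 0" by simp
  have "(conformal_factor \<kappa> x)\<^sup>2 * ((u$1)\<^sup>2 + (u$2)\<^sup>2) + (contact_form \<kappa> \<tau> x u)\<^sup>2 = 0"
    using assms(2) by (simp add: E_chart_nonpos_metric power2_eq_square)
  moreover have "(conformal_factor \<kappa> x)\<^sup>2 * ((u$1)\<^sup>2 + (u$2)\<^sup>2) \<ge> 0" by simp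
  moreover have "(contact_form \<kappa> \<tau> x u)\<^sup>2 \<ge> 0" by simp
  ultimately have A: "(conformal_factor \<kappa> x)\<^sup>2 * ((u$1)\<^sup>2 + (u$2)\<^sup>2) = 0"
    and "(contact_form \<kappa> \<tau> x u)\<^sup>2 = 0"
    by linarith+
  then have \<theta>: "contact_form \<kappa> \<tau> x u = 0" by simp
  from A have "(u$1)\<^sup>2 + (u$2)\<^sup>2 = 0" using l by simp
  then have "u$1 = 0" "u$2 = 0" by (simp_all add: sum_power2_eq_zero_iff)
  with \<theta> have "u$3 = 0" by (simp add: contact_form_def)
  with \<open>u$1 = 0\<close> \<open>u$2 = 0\<close> show ?thesis by (simp add: vec_eq_iff forall_3)
qed

lemma open_E_chart_nonpos: "open (cdom (E_chart_nonpos \<kappa> \<tau>))"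
  unfolding E_chart_nonpos_def chart.simps by (intro open_Collect_less continuous_intros)

definition base_point :: "real^3 \<Rightarrow> complex" where
  "base_point x = Complex (x$1) (x$2)"

lemma bounded_linear_base_point: "bounded_linear base_point"
  by (simp add: linear_iff base_point_def complex_eq_iff flip: linear_conv_bounded_linear)

lemma square_radius_has_derivative:
  "((\<lambda>x :: real^3. (x$1)\<^sup>2 + (x$2)\<^sup>2) has_derivative (\<lambda>u. 2 * (x$1 * u$1 + x$2 * u$2))) (at x)"
proof -
  have "((\<lambda>x :: real^3. x$1 * x$1 + x$2 * x$2) has_derivative
      (\<lambda>u. (x$1 * u$1 + u$1 * x$1) + (x$2 * u$2 + u$2 * x$2))) (at x)"
    by (intro has_derivative_add has_derivative_mult
        bounded_linear_imp_has_derivative[OF bounded_linear_vec_nth])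
  then show ?thesis by (simp add: power2_eq_square algebra_simps)
qed

lemma C_k_on_square_radius: "open U \<Longrightarrow> C_k_on k (\<lambda>x :: real^3. (x$1)\<^sup>2 + (x$2)\<^sup>2) U"
  by (intro C_k_on_add C_k_on_power C_k_on_linear[OF _ bounded_linear_vec_nth])

section \<open>Flat base: horospheres\<close>

text \<open>In terms of the null vectors \<open>pole = (1, 0, 1)\<close> and \<open>(1, 0, -1)\<close>, the lift is
  \<open>a pole + (1, 0, -1) + \<tau> \<zeta> (0, 1, 0)\<close>, with \<open>\<langle>F, F\<rangle> = 4 Re a - \<tau>\<^sup>2 |\<zeta>|\<^sup>2\<close>. The real part of \<open>a\<close>
  makes this equal to 1; the imaginary part carries the central coordinate of the Heisenberg group.\<close>

definition horosphere_lift :: "real \<Rightarrow> complex^2 \<Rightarrow> complex^3" where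
  "horosphere_lift \<tau> p =
    (let a = of_real ((\<tau>\<^sup>2 * (cmod (p$1))\<^sup>2 + 1) / 4) + \<i> * of_real (\<tau> / 2) * p$2
     in vector [a + 1, of_real \<tau> * p$1, a - 1])"

definition horosphere_height :: "real \<Rightarrow> real^3 \<Rightarrow> complex" where
  "horosphere_height \<tau> x =
     of_real (1/4 + \<tau>\<^sup>2 / 4 * ((x$1)\<^sup>2 + (x$2)\<^sup>2)) + \<i> * of_real (\<tau> / 2 * x$3)"

lemma horosphere_lift_coords:
  "horosphere_lift \<tau> (cpar (E_chart_nonpos \<kappa> \<tau>') x) =
    vector [horosphere_height \<tau> x + 1, of_real \<tau> * base_point x, horosphere_height \<tau> x - 1]"
  by (simp add: horosphere_lift_def horosphere_height_def Let_def E_chart_nonpos_def cmod_power2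
      base_point_def vec_eq_iff forall_3 complex_eq_iff field_simps)

lemma horosphere_height_has_derivative:
  "(horosphere_height \<tau> has_derivative
    (\<lambda>u. of_real (\<tau>\<^sup>2 / 2 * (x$1 * u$1 + x$2 * u$2)) + \<i> * of_real (\<tau> / 2 * u$3))) (at x)"
proof -
  have "(horosphere_height \<tau> has_derivative
    (\<lambda>u. of_real (0 + \<tau>\<^sup>2 / 4 * (2 * (x$1 * u$1 + x$2 * u$2))) + \<i> * of_real (\<tau> / 2 * u$3))) (at x)"
    unfolding horosphere_height_def[abs_def]
    by (intro has_derivative_add has_derivative_of_real has_derivative_const
        has_derivative_mult_right square_radius_has_derivative
        bounded_linear_imp_has_derivative[OF bounded_linear_vec_nth])
  then show ?thesis
    by (rule has_derivative_eq_rhs) (simp add: fun_eq_iff complex_eq_iff algebra_simps)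
qed

lemma C_k_on_horosphere_height: "open U \<Longrightarrow> C_k_on k (horosphere_height \<tau>) U"
  unfolding horosphere_height_def[abs_def]
  by (intro C_k_on_add C_k_on_mult C_k_on_const C_k_on_square_radius
      C_k_on_bounded_linear[OF _ bounded_linear_of_real] C_k_on_linear[OF _ bounded_linear_vec_nth])

lemma pole_lift_horosphere:
  fixes \<tau> :: real
  assumes \<tau>: "\<tau> \<noteq> 0"
  shows "pole_lift (- \<tau>\<^sup>2) 1 2 \<tau> (\<tau> / 2) 0 (\<tau> / 2) (E_space 0 \<tau>) (horosphere_lift \<tau>)
    (vector [1, 0, 1]) (E_vertical 0 \<tau>)"
proof -
  let ?F = "horosphere_lift \<tau>" and ?a = "horosphere_height \<tau>"
  let ?P = "E_chart_nonpos 0 \<tau>"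
  define a' where "a' x u = of_real (\<tau>\<^sup>2 / 2 * (x$1 * u$1 + x$2 * u$2)) + \<i> * of_real (\<tau> / 2 * u$3)"
    for x u :: "real^3"
  have sgn: "sgn (- \<tau>\<^sup>2) = - 1" using \<tau> by (simp add: sgn_if)
  have form: "hform (- \<tau>\<^sup>2) (vector [p, q, r]) (vector [p', q', r']) = p * cnj p' - q * cnj q' - r * cnj r'"
    for p q r p' q' r' unfolding hform_def sgn by simp
  have lift': "lift_derivative ?F ?P x u = vector [a' x u, of_real \<tau> * base_point u, a' x u]" for x u
  proof -
    have "((\<lambda>x. ?F (cpar ?P x)) has_derivative
        (\<lambda>u. vector [a' x u + 0, of_real \<tau> * base_point u, a' x u - 0])) (at x)"
      unfolding horosphere_lift_coords a'_def
      by (intro has_derivative_vector_3 has_derivative_add has_derivative_diff has_derivative_const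
          horosphere_height_has_derivative has_derivative_mult_right
          bounded_linear_imp_has_derivative[OF bounded_linear_base_point])
    then show ?thesis
      unfolding lift_derivative_def by (simp add: frechet_derivative_at[symmetric])
  qed
  have l: "conformal_factor 0 x = 1" for x by (simp add: conformal_factor_def)
  show ?thesis
  proof (rule pole_lift.intro)
    show "- \<tau>\<^sup>2 \<noteq> 0" "(1 :: real) > 0" "\<tau> \<noteq> 0" "\<tau> / 2 \<noteq> 0" using \<tau> by auto
    show "(\<tau> / 2)\<^sup>2 * (1 * Re (hform (- \<tau>\<^sup>2) (vector [1, 0, 1]) (vector [1, 0, 1])) - 2\<^sup>2) = - \<tau>\<^sup>2 * 1\<^sup>2"
      by (simp add: form power_divide)
  next
    fix P x assume "P \<in> E_space 0 \<tau>"
    then have P: "P = ?P" by (simp add: E_space_def)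
    note vertical = E_chart_nonpos_vertical[OF order_refl, of \<tau>]
    have "C_k_on n (\<lambda>x. ?a x + (- 1)) (cdom ?P)" for n
      by (intro C_k_on_add C_k_on_const C_k_on_horosphere_height open_E_chart_nonpos)
    then have "C_k_on n (\<lambda>x. ?a x - 1) (cdom ?P)" for n by simp
    then have "C_k_on n (\<lambda>x. ?F (cpar ?P x)) (cdom ?P)" for n
      unfolding horosphere_lift_coords
      by (intro C_k_on_vector_3 C_k_on_add C_k_on_mult C_k_on_const C_k_on_horosphere_height
          open_E_chart_nonpos C_k_on_linear[OF _ bounded_linear_base_point])
    then show "C_infinity_on (\<lambda>x. ?F (cpar P x)) (cdom P)"
      unfolding P by (intro C_infinity_onI open_E_chart_nonpos)
    show "hform (- \<tau>\<^sup>2) (?F (cpar P x)) (?F (cpar P x)) = of_real 1"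
      unfolding P horosphere_lift_coords form
      by (simp add: complex_eq_iff horosphere_height_def base_point_def) (simp add: power2_eq_square algebra_simps)
    show "hform (- \<tau>\<^sup>2) (vector [1, 0, 1]) (?F (cpar P x)) = of_real 2"
      unfolding P horosphere_lift_coords form by simp
    show "hform (- \<tau>\<^sup>2) (lift_derivative ?F P x u) (?F (cpar P x))
        = \<i> * of_real (\<tau> * cmet P x (E_vertical 0 \<tau> P x) u)" for u
      unfolding P horosphere_lift_coords form lift' vertical
      by (simp add: complex_eq_iff a'_def base_point_def contact_form_def l)
        (simp add: power2_eq_square field_simps)
    show "Re (hform (- \<tau>\<^sup>2) (lift_derivative ?F P x u) (lift_derivative ?F P x v)) / 1
        - \<tau>\<^sup>2 * cmet P x (E_vertical 0 \<tau> P x) u * cmet P x (E_vertical 0 \<tau> P x) v / 1\<^sup>2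
        = - \<tau>\<^sup>2 * cmet P x u v" for u v
    proof -
      have re: "Re (hform (- \<tau>\<^sup>2) (lift_derivative ?F ?P x u) (lift_derivative ?F ?P x v))
          = - \<tau>\<^sup>2 * (u$1 * v$1 + u$2 * v$2)"
        unfolding form lift' by (simp add: base_point_def power2_eq_square algebra_simps)
      show ?thesis
        unfolding P re vertical unfolding E_chart_nonpos_metric l
        by (simp add: distrib_left)
    qed
    show "lift_derivative ?F P x (E_vertical 0 \<tau> P x)
        = \<i> *s ((\<tau> / 2) *\<^sub>R vector [1, 0, 1] + 0 *\<^sub>R ?F (cpar P x))"
      unfolding P lift' vertical
      by (simp add: vec_eq_iff forall_3 a'_def axis_def base_point_def complex_eq_iff)
    show "cmet P x (E_vertical 0 \<tau> P x) (E_vertical 0 \<tau> P x) = 1"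
      unfolding P vertical by simp
    show "u = 0" if "x \<in> cdom P" "cmet P x u u = 0" for u
      using that unfolding P by (rule E_chart_nonpos_definite)
  qed
qed

section \<open>Negative base curvature: tubes around a complex geodesic\<close>

text \<open>The factor \<open>G\<close> multiplies the lift \<open>(1, \<alpha> \<zeta>)\<close> of the complex geodesic \<open>{Z. Z$3 = 0}\<close>, where
  \<open>\<alpha>\<^sup>2 = - \<kappa> / 4\<close>: its modulus normalizes this lift, its phase carries the coordinate of the fibers. The
  constant last entry is the component along the pole \<open>(0, 0, 1)\<close>, which is orthogonal to the geodesic.\<close>

definition tube_lift :: "real \<Rightarrow> real \<Rightarrow> real \<Rightarrow> complex^2 \<Rightarrow> complex^3" where
  "tube_lift \<kappa> \<gamma> \<beta> p =
    (let G = of_real (inverse (sqrt (1 + \<kappa> / 4 * (cmod (p$1))\<^sup>2))) * exp (- \<i> * of_real \<gamma> * p$2)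
     in vector [G, of_real (sqrt (- \<kappa> / 4)) * p$1 * G, of_real \<beta>])"

definition tube_scale :: "real \<Rightarrow> real \<Rightarrow> real^3 \<Rightarrow> complex" where
  "tube_scale \<kappa> \<gamma> x = of_real (inverse (sqrt (1 + \<kappa> / 4 * ((x$1)\<^sup>2 + (x$2)\<^sup>2))))
     * exp (\<i> * of_real (- \<gamma> * x$3))"

lemma tube_lift_coords:
  "tube_lift \<kappa> \<gamma> \<beta> (cpar (E_chart_nonpos \<kappa>' \<tau>) x) =
    vector [tube_scale \<kappa> \<gamma> x, of_real (sqrt (- \<kappa> / 4)) * base_point x * tube_scale \<kappa> \<gamma> x, of_real \<beta>]"
  by (simp add: tube_lift_def tube_scale_def Let_def E_chart_nonpos_def cmod_power2 base_point_def
      mult.assoc)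

lemma tube_scale_norm:
  assumes "x \<in> cdom (E_chart_nonpos \<kappa> \<tau>)"
  shows "tube_scale \<kappa> \<gamma> x * cnj (tube_scale \<kappa> \<gamma> x) = of_real (conformal_factor \<kappa> x)"
proof -
  define D where "D = 1 + \<kappa> / 4 * ((x$1)\<^sup>2 + (x$2)\<^sup>2)"
  have D: "D > 0" using assms by (simp add: E_chart_nonpos_def D_def)
  have "(cmod (tube_scale \<kappa> \<gamma> x))\<^sup>2 = (inverse (sqrt D))\<^sup>2"
    unfolding tube_scale_def D_def
    by (simp only: norm_mult norm_exp_i_times norm_of_real mult_1_right power2_abs)
  also have "\<dots> = conformal_factor \<kappa> x"
    using D by (simp only: conformal_factor_inverse power_inverse real_sqrt_pow2 less_imp_le flip: D_def)
  finally show ?thesis by (metis complex_norm_square)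
qed

lemma tube_scale_has_derivative:
  assumes "x \<in> cdom (E_chart_nonpos \<kappa> \<tau>)"
  shows "(tube_scale \<kappa> \<gamma> has_derivative (\<lambda>u. tube_scale \<kappa> \<gamma> x *
    (of_real (- \<kappa> / 4 * conformal_factor \<kappa> x * (x$1 * u$1 + x$2 * u$2)) - \<i> * of_real (\<gamma> * u$3)))) (at x)"
proof -
  define D where "D x = 1 + \<kappa> / 4 * ((x$1)\<^sup>2 + (x$2)\<^sup>2)" for x :: "real^3"
  have pos: "D x > 0" using assms by (simp add: E_chart_nonpos_def D_def)
  have D': "(D has_derivative (\<lambda>u. 0 + \<kappa> / 4 * (2 * (x$1 * u$1 + x$2 * u$2)))) (at x)"
    unfolding D_def[abs_def]
    by (intro has_derivative_add has_derivative_const has_derivative_mult_right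
        square_radius_has_derivative)
  have e': "((\<lambda>x :: real^3. exp (\<i> * of_real (- \<gamma> * x$3))) has_derivative
      (\<lambda>u. exp (\<i> * of_real (- \<gamma> * x$3)) * (\<i> * of_real (- \<gamma> * u$3)))) (at x)"
    by (rule has_derivative_compose[OF _ DERIV_exp[unfolded has_field_derivative_def]])
      (intro has_derivative_mult_right has_derivative_of_real
        bounded_linear_imp_has_derivative[OF bounded_linear_vec_nth])
  have "inverse (sqrt (D x)) ^ 3 = inverse (sqrt (D x)) * inverse (D x)"
    using pos by (simp add: power3_eq_cube flip: inverse_mult_distrib)
  then have g': "of_real (- (1/2) * (inverse (sqrt (D x)) ^ 3 * (0 + \<kappa> / 4 * (2 * (x$1 * u$1 + x$2 * u$2)))))
     = complex_of_real (inverse (sqrt (D x))) * of_real (- \<kappa> / 4 * inverse (D x) * (x$1 * u$1 + x$2 * u$2))" for u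
    by (simp only: of_real_mult[symmetric] of_real_eq_iff) simp
  have "((\<lambda>x. complex_of_real (inverse (sqrt (D x)))) has_derivative
      (\<lambda>u. of_real (- (1/2) * (inverse (sqrt (D x)) ^ 3 * (0 + \<kappa> / 4 * (2 * (x$1 * u$1 + x$2 * u$2))))))) (at x)"
    by (rule has_derivative_of_real[OF has_derivative_inverse_sqrt[OF D' pos]])
  from has_derivative_mult[OF this[unfolded g'] e']
  have "((\<lambda>x. of_real (inverse (sqrt (D x))) * exp (\<i> * of_real (- \<gamma> * x$3))) has_derivative
     (\<lambda>u. of_real (inverse (sqrt (D x))) * (exp (\<i> * of_real (- \<gamma> * x$3)) * (\<i> * of_real (- \<gamma> * u$3)))
       + of_real (inverse (sqrt (D x))) * of_real (- \<kappa> / 4 * inverse (D x) * (x$1 * u$1 + x$2 * u$2))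
         * exp (\<i> * of_real (- \<gamma> * x$3)))) (at x)"
    .
  then show ?thesis
    unfolding tube_scale_def[abs_def] conformal_factor_inverse D_def
    by (rule has_derivative_eq_rhs) (simp add: fun_eq_iff algebra_simps)
qed

lemma C_k_on_tube_scale: "C_k_on k (tube_scale \<kappa> \<gamma>) (cdom (E_chart_nonpos \<kappa> \<tau>))"
  unfolding tube_scale_def[abs_def]
  by (intro C_k_on_mult C_k_on_exp C_k_on_bounded_linear[OF _ bounded_linear_of_real]
      C_k_on_inverse_sqrt C_k_on_add C_k_on_const C_k_on_square_radius open_E_chart_nonpos
      C_k_on_linear[OF _ bounded_linear_vec_nth])
    (simp add: E_chart_nonpos_def)

lemma tube_lift_has_derivative:
  fixes \<kappa> \<tau> \<gamma> \<beta> :: real and x :: "real^3"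
  assumes "x \<in> cdom (E_chart_nonpos \<kappa> \<tau>)"
  defines "\<mu> \<equiv> \<lambda>u. of_real (- \<kappa> / 4 * conformal_factor \<kappa> x * (x$1 * u$1 + x$2 * u$2)) - \<i> * of_real (\<gamma> * u$3)"
  shows "((\<lambda>x. tube_lift \<kappa> \<gamma> \<beta> (cpar (E_chart_nonpos \<kappa> \<tau>) x)) has_derivative
    (\<lambda>u. vector [tube_scale \<kappa> \<gamma> x * \<mu> u,
      of_real (sqrt (- \<kappa> / 4)) * (base_point u + base_point x * \<mu> u) * tube_scale \<kappa> \<gamma> x, 0])) (at x)"
proof -
  have "((\<lambda>x. tube_lift \<kappa> \<gamma> \<beta> (cpar (E_chart_nonpos \<kappa> \<tau>) x)) has_derivative
    (\<lambda>u. vector [tube_scale \<kappa> \<gamma> x * \<mu> u,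
      of_real (sqrt (- \<kappa> / 4)) * base_point x * (tube_scale \<kappa> \<gamma> x * \<mu> u)
      + of_real (sqrt (- \<kappa> / 4)) * base_point u * tube_scale \<kappa> \<gamma> x, 0])) (at x)"
    unfolding tube_lift_coords \<mu>_def
    by (rule has_derivative_vector_3[OF tube_scale_has_derivative[OF assms(1)]
          has_derivative_mult[OF has_derivative_mult_right[OF bounded_linear_imp_has_derivative[OF
                bounded_linear_base_point]] tube_scale_has_derivative[OF assms(1)]]
          has_derivative_const])
  then show ?thesis
    by (rule has_derivative_eq_rhs) (simp add: algebra_simps)
qed

text \<open>The constants are forced: \<open>\<langle>dF, F\<rangle>\<close> is \<open>- \<i> \<gamma> (dz - (\<kappa> / (4 \<gamma>)) \<lambda> (x dy - y dx))\<close>,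
  which is a multiple of \<open>\<eta>\<close> for \<open>\<gamma> \<tau> = \<kappa> / 4\<close>; the horizontal part of the induced metric
  is \<open>\<kappa> / (4 c k) \<lambda>\<^sup>2 (dx\<^sup>2 + dy\<^sup>2)\<close>, whence \<open>k = \<kappa> / (4 c)\<close>; and \<open>\<langle>F, F\<rangle> = 1 - \<beta>\<^sup>2\<close>.\<close>

lemma pole_lift_tube:
  fixes \<kappa> \<tau> :: real
  defines "c \<equiv> \<kappa> / 4 - \<tau>\<^sup>2" and "\<gamma> \<equiv> \<kappa> / (4 * \<tau>)"
  defines "k \<equiv> \<kappa> / (4 * c)" and "\<beta> \<equiv> \<bar>\<tau>\<bar> / sqrt (- c)"
  assumes \<kappa>: "\<kappa> < 0" and \<tau>: "\<tau> \<noteq> 0"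
  shows "pole_lift c k (- \<beta>) (- \<gamma>) (\<gamma> * \<beta>) (- \<gamma>) (sqrt (- c) * k)
    (E_space \<kappa> \<tau>) (tube_lift \<kappa> \<gamma> \<beta>) (vector [0, 0, 1]) (E_vertical \<kappa> \<tau>)"
proof -
  let ?F = "tube_lift \<kappa> \<gamma> \<beta>" and ?P = "E_chart_nonpos \<kappa> \<tau>" and ?G = "tube_scale \<kappa> \<gamma>"
  define a where "a = - \<kappa> / 4"
  define \<alpha> where "\<alpha> = complex_of_real (sqrt a)"
  have c: "c < 0" using \<kappa> \<tau> zero_less_power2[of \<tau>] unfolding c_def by linarith
  have \<alpha>: "\<alpha> * \<alpha> = of_real a" "cnj \<alpha> = \<alpha>"
    using \<kappa> by (simp_all add: \<alpha>_def a_def flip: of_real_mult)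
  have \<beta>2: "\<beta>\<^sup>2 = - \<tau>\<^sup>2 / c" using c by (simp add: \<beta>_def power_divide)
  have k_eq: "k + \<beta>\<^sup>2 = 1"
  proof -
    have "k + \<beta>\<^sup>2 = (\<kappa> / 4 - \<tau>\<^sup>2) / c"
      unfolding \<beta>2 k_def by (simp add: diff_divide_distrib)
    also have "\<dots> = 1" unfolding c_def[symmetric] using c by simp
    finally show ?thesis .
  qed
  have a\<gamma>: "\<gamma> * \<tau> = - a" using \<tau> by (simp add: a_def \<gamma>_def)
  have "k > 0" using \<kappa> c by (simp add: k_def zero_less_divide_iff)
  have form: "hform c (vector [p, q, r]) (vector [p', q', r']) = p * cnj p' - q * cnj q' - r * cnj r'"
    for p q r p' q' r' using c by (simp add: hform_def sgn_if)
  show ?thesis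
  proof (rule pole_lift.intro)
    show "c \<noteq> 0" "k > 0" "- \<gamma> \<noteq> 0" "\<gamma> * \<beta> \<noteq> 0"
      using c \<kappa> \<tau> \<open>k > 0\<close> by (auto simp: \<gamma>_def \<beta>_def)
    have "(sqrt (- c) * k)\<^sup>2 * (- (k + \<beta>\<^sup>2)) = c * k\<^sup>2"
      unfolding k_eq using c by (simp add: power_mult_distrib)
    then show "(sqrt (- c) * k)\<^sup>2 * (k * Re (hform c (vector [0, 0, 1]) (vector [0, 0, 1])) - (- \<beta>)\<^sup>2) = c * k\<^sup>2"
      by (simp add: form)
  next
    fix P assume "P \<in> E_space \<kappa> \<tau>"
    then have P: "P = ?P" using \<kappa> by (simp add: E_space_def)
    have "C_k_on n (\<lambda>x. ?F (cpar ?P x)) (cdom ?P)" for n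
      unfolding tube_lift_coords
      by (intro C_k_on_vector_3 C_k_on_mult C_k_on_const C_k_on_tube_scale open_E_chart_nonpos
          C_k_on_linear[OF _ bounded_linear_base_point])
    then show "C_infinity_on (\<lambda>x. ?F (cpar P x)) (cdom P)"
      unfolding P by (intro C_infinity_onI open_E_chart_nonpos)
    fix x assume "x \<in> cdom P"
    then have x: "x \<in> cdom ?P" by (simp add: P)
    define L n where "L = conformal_factor \<kappa> x" and "n = (x$1)\<^sup>2 + (x$2)\<^sup>2"
    define p w where "p u = x$1 * u$1 + x$2 * u$2" and "w u = x$1 * u$2 - x$2 * u$1" for u :: "real^3"
    define \<mu> where "\<mu> u = complex_of_real (a * L * p u) - \<i> * of_real (\<gamma> * u$3)" for u
    let ?\<theta> = "contact_form \<kappa> \<tau> x"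
    have L: "L * (1 - a * n) = 1"
    proof -
      have "1 + \<kappa> / 4 * n > 0" using x by (simp add: E_chart_nonpos_def n_def)
      then show ?thesis unfolding L_def conformal_factor_inverse n_def[symmetric] a_def by simp
    qed
    then have L': "complex_of_real L * (1 - of_real a * of_real n) = 1"
      by (metis of_real_1 of_real_diff of_real_mult)
    have G: "?G x * cnj (?G x) = of_real L"
      unfolding L_def by (rule tube_scale_norm[OF x])
    have \<zeta>: "base_point x * cnj (base_point x) = of_real n"
      by (simp add: base_point_def n_def complex_eq_iff power2_eq_square)
    have u\<zeta>: "base_point u * cnj (base_point x) = of_real (p u) + \<i> * of_real (w u)" for u
      by (simp add: base_point_def p_def w_def complex_eq_iff algebra_simps)
    have \<gamma>\<theta>: "\<gamma> * ?\<theta> u = \<gamma> * u$3 + a * L * w u" for u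
    proof -
      have "\<gamma> * ?\<theta> u = \<gamma> * u$3 + (\<gamma> * \<tau>) * L * (- w u)"
        by (simp add: contact_form_def L_def w_def algebra_simps)
      then show ?thesis unfolding a\<gamma> by simp
    qed
    have F: "?F (cpar ?P x) = vector [?G x, \<alpha> * base_point x * ?G x, of_real \<beta>]"
      unfolding tube_lift_coords \<alpha>_def a_def ..
    have lift': "lift_derivative ?F ?P x u =
        vector [?G x * \<mu> u, \<alpha> * (base_point u + base_point x * \<mu> u) * ?G x, 0]" for u
      unfolding lift_derivative_def
      by (simp only: frechet_derivative_at[OF tube_lift_has_derivative[OF x], symmetric]
          \<mu>_def \<alpha>_def a_def p_def L_def)
    have vertical: "E_vertical \<kappa> \<tau> ?P x = axis 3 1" "cmet ?P x (axis 3 1) u = ?\<theta> u" for u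
      using E_chart_nonpos_vertical[of \<kappa>] \<kappa> by simp_all
    show "hform c (?F (cpar P x)) (?F (cpar P x)) = of_real k"
    proof -
      have "hform c (?F (cpar P x)) (?F (cpar P x)) =
          (?G x * cnj (?G x)) * (1 - (\<alpha> * cnj \<alpha>) * (base_point x * cnj (base_point x))) - of_real (\<beta>\<^sup>2)"
        unfolding P F form by (simp add: power2_eq_square algebra_simps)
      also have "\<dots> = 1 - of_real (\<beta>\<^sup>2)"
        unfolding G \<zeta> \<alpha> L' ..
      also have "\<dots> = of_real (1 - \<beta>\<^sup>2)" by simp
      also have "1 - \<beta>\<^sup>2 = k" using k_eq by linarith
      finally show ?thesis .
    qed
    show "hform c (vector [0, 0, 1]) (?F (cpar P x)) = of_real (- \<beta>)"
      unfolding P F form by simp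
    show "hform c (lift_derivative ?F P x u) (?F (cpar P x))
        = \<i> * of_real (- \<gamma> * cmet P x (E_vertical \<kappa> \<tau> P x) u)" for u
    proof -
      have "hform c (lift_derivative ?F P x u) (?F (cpar P x)) =
          (?G x * cnj (?G x)) * (\<mu> u - (\<alpha> * cnj \<alpha>) *
            (base_point u * cnj (base_point x) + base_point x * cnj (base_point x) * \<mu> u))"
        unfolding P F lift' form by (simp add: algebra_simps)
      also have "\<dots> = (of_real L * (1 - of_real a * of_real n)) * \<mu> u
          - of_real a * of_real L * (of_real (p u) + \<i> * of_real (w u))"
        unfolding G \<zeta> \<alpha> unfolding u\<zeta> by (simp add: algebra_simps)
      also have "\<dots> = - \<i> * of_real (\<gamma> * u$3 + a * L * w u)"
        unfolding L' by (simp add: \<mu>_def algebra_simps)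
      also have "\<dots> = \<i> * of_real (- (\<gamma> * ?\<theta> u))" unfolding \<gamma>\<theta> by (simp add: algebra_simps)
      finally show ?thesis unfolding P vertical by simp
    qed
    show "Re (hform c (lift_derivative ?F P x u) (lift_derivative ?F P x v)) / k
        - (- \<gamma>)\<^sup>2 * cmet P x (E_vertical \<kappa> \<tau> P x) u * cmet P x (E_vertical \<kappa> \<tau> P x) v / k\<^sup>2
        = c * cmet P x u v" for u v
    proof -
      define D where "D = u$1 * v$1 + u$2 * v$2"
      have "cnj (base_point v * cnj (base_point x)) = cnj (of_real (p v) + \<i> * of_real (w v))"
        unfolding u\<zeta> ..
      then have v\<zeta>: "base_point x * cnj (base_point v) = of_real (p v) - \<i> * of_real (w v)"
        by (simp add: mult.commute)
      have "hform c (lift_derivative ?F P x u) (lift_derivative ?F P x v) =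
          (?G x * cnj (?G x)) * (\<mu> u * cnj (\<mu> v) - (\<alpha> * cnj \<alpha>) *
            (base_point u * cnj (base_point v) + (base_point u * cnj (base_point x)) * cnj (\<mu> v)
             + (base_point x * cnj (base_point v)) * \<mu> u
             + (base_point x * cnj (base_point x)) * (\<mu> u * cnj (\<mu> v))))"
        unfolding P lift' form by (simp add: algebra_simps)
      also have "\<dots> = (of_real L * (1 - of_real a * of_real n)) * (\<mu> u * cnj (\<mu> v))
          - of_real (a * L) * (base_point u * cnj (base_point v)
            + (of_real (p u) + \<i> * of_real (w u)) * cnj (\<mu> v)
            + (of_real (p v) - \<i> * of_real (w v)) * \<mu> u)"
        unfolding G \<zeta> \<alpha> unfolding u\<zeta> v\<zeta> by (simp add: algebra_simps)
      finally have "Re (hform c (lift_derivative ?F P x u) (lift_derivative ?F P x v)) =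
          ((a * L * p u) * (a * L * p v) + \<gamma> * u$3 * (\<gamma> * v$3))
          - a * L * (D + (p u * (a * L * p v) - w u * (\<gamma> * v$3))
            + (p v * (a * L * p u) - w v * (\<gamma> * u$3)))"
        unfolding L' by (simp add: \<mu>_def D_def base_point_def)
      also have "\<dots> = (\<gamma> * ?\<theta> u) * (\<gamma> * ?\<theta> v) - a * L * (D + a * L * (p u * p v + w u * w v))"
        unfolding \<gamma>\<theta> by (simp add: algebra_simps)
      \<comment> \<open>Lagrange's identity in the plane: the radial and angular components of \<open>u\<close> and \<open>v\<close> recombine into
        the Euclidean product, which leaves \<open>\<eta>\<close> and the conformal metric of the base.\<close>
      also have "p u * p v + w u * w v = n * D"
        by (simp add: p_def w_def n_def D_def power2_eq_square algebra_simps)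
      also have "D + a * L * (n * D) = L * D"
      proof -
        have "1 + a * L * n = L" using L by (simp add: algebra_simps)
        then have "(1 + a * L * n) * D = L * D" by (simp only:)
        then show ?thesis by (simp add: algebra_simps)
      qed
      finally have re: "Re (hform c (lift_derivative ?F P x u) (lift_derivative ?F P x v)) =
          \<gamma>\<^sup>2 * (?\<theta> u * ?\<theta> v) - a * (L\<^sup>2 * D)"
        by (simp add: power2_eq_square)
      have ak: "a / k = - c" using \<kappa> c by (simp add: a_def k_def)
      have "\<gamma>\<^sup>2 / k - \<gamma>\<^sup>2 / k\<^sup>2 = c * ((\<kappa> / 4 - c) / \<tau>\<^sup>2)"
        using \<kappa> \<tau> c by (simp add: \<gamma>_def k_def field_simps power2_eq_square)
      also have "(\<kappa> / 4 - c) / \<tau>\<^sup>2 = 1" using \<tau> by (simp add: c_def)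
      finally have gk: "\<gamma>\<^sup>2 / k - \<gamma>\<^sup>2 / k\<^sup>2 = c" by simp
      have "(\<gamma>\<^sup>2 * (?\<theta> u * ?\<theta> v) - a * (L\<^sup>2 * D)) / k - (- \<gamma>)\<^sup>2 * ?\<theta> u * ?\<theta> v / k\<^sup>2
          = (\<gamma>\<^sup>2 / k - \<gamma>\<^sup>2 / k\<^sup>2) * (?\<theta> u * ?\<theta> v) - (a / k) * (L\<^sup>2 * D)"
        by (simp add: algebra_simps diff_divide_distrib)
      also have "\<dots> = c * (L\<^sup>2 * D + ?\<theta> u * ?\<theta> v)"
        unfolding gk ak by (simp add: algebra_simps)
      finally have "(\<gamma>\<^sup>2 * (?\<theta> u * ?\<theta> v) - a * (L\<^sup>2 * D)) / k - (- \<gamma>)\<^sup>2 * ?\<theta> u * ?\<theta> v / k\<^sup>2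
          = c * (L\<^sup>2 * D + ?\<theta> u * ?\<theta> v)" .
      moreover have "cmet ?P x u v = L\<^sup>2 * D + ?\<theta> u * ?\<theta> v"
        unfolding E_chart_nonpos_metric L_def D_def ..
      ultimately show ?thesis
        unfolding re unfolding P vertical by (simp only:)
    qed
    show "lift_derivative ?F P x (E_vertical \<kappa> \<tau> P x)
        = \<i> *s ((\<gamma> * \<beta>) *\<^sub>R vector [0, 0, 1] + (- \<gamma>) *\<^sub>R ?F (cpar P x))"
    proof -
      have "\<mu> (axis 3 1) = - \<i> * of_real \<gamma>" by (simp add: \<mu>_def p_def axis_def)
      moreover have "base_point (axis 3 1) = 0" by (simp add: base_point_def axis_def complex_eq_iff)
      ultimately show ?thesis
        unfolding P vertical lift' F
        by (simp add: vec_eq_iff forall_3 scaleR_conv_of_real[where 'a=complex] algebra_simps)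
    qed
    show "cmet P x (E_vertical \<kappa> \<tau> P x) (E_vertical \<kappa> \<tau> P x) = 1"
      unfolding P vertical by simp
    show "u = 0" if "cmet P x u u = 0" for u
      using x that unfolding P by (rule E_chart_nonpos_definite)
  qed
qed

section \<open>The isometric immersions\<close>

theorem proposition4p2:
  fixes \<kappa> \<tau> :: real
  assumes "\<tau> \<noteq> 0" and "\<kappa> - 4 * \<tau>\<^sup>2 \<noteq> 0"
  shows "\<exists>c::real. c \<noteq> 0 \<and>
    (\<exists>f N. isometric_immersion (E_space \<kappa> \<tau>) (M4_space c) f \<and>
       unit_normal_field (E_space \<kappa> \<tau>) (M4_space c) f N \<and>
       constant_mean_curvature (E_space \<kappa> \<tau>) (M4_space c) f N \<and>
       eta_umbilic (E_vertical \<kappa> \<tau>) (E_space \<kappa> \<tau>) (M4_space c) f N)"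
proof -
  define c where "c = \<kappa> / 4 - \<tau>\<^sup>2"
  have c: "c \<noteq> 0" using assms(2) by (simp add: c_def)
  have "\<exists>k m \<rho> \<delta> \<delta>' \<nu> F pole.
      pole_lift c k m \<rho> \<delta> \<delta>' \<nu> (E_space \<kappa> \<tau>) F pole (E_vertical \<kappa> \<tau>)"
  proof (cases \<kappa> "0 :: real" rule: linorder_cases)
    case less
    then show ?thesis using pole_lift_tube[OF less assms(1)] unfolding c_def by blast
  next
    case equal
    then have "pole_lift c 1 2 \<tau> (\<tau> / 2) 0 (\<tau> / 2) (E_space \<kappa> \<tau>) (horosphere_lift \<tau>)
        (vector [1, 0, 1]) (E_vertical \<kappa> \<tau>)"
      using pole_lift_horosphere[OF assms(1)] by (simp add: c_def)
    then show ?thesis by blast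
  next
    case greater
    then show ?thesis using pole_lift_sphere[OF greater assms(1)] c unfolding c_def by blast
  qed
  then obtain k m \<rho> \<delta> \<delta>' \<nu> F pole
    where "pole_lift c k m \<rho> \<delta> \<delta>' \<nu> (E_space \<kappa> \<tau>) F pole (E_vertical \<kappa> \<tau>)"
    by blast
  then interpret pole_lift c k m \<rho> \<delta> \<delta>' \<nu> "E_space \<kappa> \<tau>" F pole "E_vertical \<kappa> \<tau>" .
  show ?thesis
    using c eta_umbilic_immersion
    by (intro exI[of _ c] exI[of _ immersion] exI[of _ normal] conjI)
qed

end
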